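(* Under the von Mises flat model with parameters $(N,K,\kappa)$, as $N\to\infty$, strong detection is possible with the interval test in each of the following regimes. For $\tau\in(0,1)$ write $p_\kappa(\tau)=\Pr\{\mathrm{vonMises}(0,\kappa)\in[-\pi\tau,\pi\tau]\}$, $g=K(p_\kappa(\tau)-\tau)$ and $\gamma_N=N\tau+g-c_N\sqrt{N\tau+g}$. (i) $K=N^\alpha$ with $0<\alpha\le1/2$, and $\frac1{\sqrt\kappa}=\frac{K^2}{c_1N\log N}$ for a constant $c_1>c_0$, where $$c_0=\frac2\pi\min_{c_2>0}\frac{c_2}{(1-2Q(c_2))^2}\approx 0.5057,\qquad c_2^\star\approx 0.7518\ \text{(a minimizer)},$$ and $Q$ is the complementary CDF of the standard Gaussian distribution. Here the test uses window length $2\pi\tau$ with $\tau=c_2^\star/(\pi\sqrt\kappa)$, and threshold $\gamma_N$ with $c_N$ chosen so that $c_N\to\infty$ and $c_N=o(\sqrt{\log N})$. (ii) $K=N^\alpha$ with $1/2<\alpha<1$, and $\kappa=\Omega(1)$. Here the test uses window length $2\pi\tau$ with $\tau\in[\epsilon,1-\epsilon]$ for some constant $\epsilon\in(0,1/2)$, and threshold $\gamma_N$ with $c_N$ chosen so that $c_N\to\infty$ and $c_N=o(K/\sqrt N)$.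
   Context: $I_0(\kappa)=\frac1{2\pi}\int_0^{2\pi}e^{\kappa\cos u}\,du$. $\mathrm{vonMises}(\Theta,\kappa)$ ($\kappa>0$) is the distribution on the circle (angles modulo $2\pi$) with density $\frac{1}{2\pi I_0(\kappa)}\exp(\kappa\cos(\theta-\Theta))$. Von Mises flat model $(N,K,\kappa)$, with $K$ and $\kappa>0$ possibly depending on $N$: angles $X=(X_1,\dots,X_N)\in[0,2\pi)^N$ are observed. Under $H_0$ (law $\mathbb{Q}$) the $X_i$ are i.i.d. uniform on $[0,2\pi)$. Under $H_1$ (law $\mathbb{P}$), a subset $S^*\subset[N]=\{1,\dots,N\}$ is drawn uniformly at random among subsets of size $K$, a phase $\Theta^*$ is drawn independently and uniformly on $[0,2\pi)$, and given $(S^*,\Theta^* )$ the $X_i$ are independent with $X_i\sim\mathrm{vonMises}(\Theta^*,\kappa)$ for $i\in S^*$ and $X_i$ uniform on $[0,2\pi)$ for $i\notin S^*$; $\mathbb{P}$ is the resulting mixture law of $X$. All arcs are understood modulo $2\pi$. A test is a measurable function $\phi$ of the data with values in $\{0,1\}$ ($1$ means reject $H_0$). $p_{\mathrm{fa}}(\phi)=\mathbb{Q}\{\phi(X)=1\}$ and $p_{\mathrm{miss}}(\phi)=\mathbb{P}\{\phi(X)=0\}$. Strong detection is possible if some sequence of tests has $p_{\mathrm{fa}}\to0$ and $p_{\mathrm{miss}}\to0$. Interval test with window length $2\pi\tau$ and threshold $\gamma$: reject $H_0$ if and only if $\sup_{\theta\in[0,2\pi)}\sum_{i=1}^N\mathbf{1}\{X_i\in[\theta,\theta+2\pi\tau]\}\ge\gamma$.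 $\log$ is the natural logarithm.
   Formalization: The decimals c_0 ≈ 0.5057 and c_2* ≈ 0.7518 contradict the displayed formula (its minimum gives c_0 ≈ 1.268 at c_2 ≈ 1.40) and are dropped; c_0 and c_2* are defined by the formula, with existence of a minimizer proved. *)

theory Defs
  imports "HOL-Probability.Probability" "HOL-Library.Landau_Symbols"
begin

text \<open>Angles are represented by their representatives in \<open>[0, 2\<pi>)\<close>.\<close>

definition circle_measure :: "real measure" where
  "circle_measure = restrict_space lborel {0..<2 * pi}"

definition bessel_I0 :: "real \<Rightarrow> real" where
  "bessel_I0 \<kappa> = 1 / (2 * pi) * (LINT u:{0..2 * pi}|lborel. exp (\<kappa> * cos u))"

definition uniform_angle :: "real measure" where
  "uniform_angle = uniform_measure circle_measure {0..<2 * pi}"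

definition von_mises :: "real \<Rightarrow> real \<Rightarrow> real measure" where
  "von_mises \<Theta> \<kappa> = density circle_measure
     (\<lambda>\<theta>. ennreal (1 / (2 * pi * bessel_I0 \<kappa>) * exp (\<kappa> * cos (\<theta> - \<Theta>))))"

text \<open>The closed arc \<open>[a, b]\<close>, understood modulo \<open>2\<pi>\<close>.\<close>

definition circle_arc :: "real \<Rightarrow> real \<Rightarrow> real set" where
  "circle_arc a b = {x. \<exists>k::int. x + 2 * pi * of_int k \<in> {a..b}}"

text \<open>The laws of the observations \<open>X\<^sub>1, \<dots>, X\<^sub>N\<close> under the two hypotheses. The planted law
  mixes over a uniform subset \<open>S\<close> of size \<open>K\<close> and an independent uniform phase \<open>\<Theta>\<close>; it is
  meaningful for \<open>K \<le> N\<close>.\<close>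

definition null_law :: "nat \<Rightarrow> (nat \<Rightarrow> real) measure" where
  "null_law N = (\<Pi>\<^sub>M i\<in>{1..N}. uniform_angle)"

definition planted_law :: "nat \<Rightarrow> nat \<Rightarrow> real \<Rightarrow> (nat \<Rightarrow> real) measure" where
  "planted_law N K \<kappa> = do {
     S \<leftarrow> measure_pmf (pmf_of_set {S. S \<subseteq> {1..N} \<and> card S = K});
     \<Theta> \<leftarrow> uniform_angle;
     (\<Pi>\<^sub>M i\<in>{1..N}. if i \<in> S then von_mises \<Theta> \<kappa> else uniform_angle)
   }"

text \<open>A test is a Boolean function of the data; the value \<open>True\<close> means that the null
  hypothesis is rejected.\<close>

definition is_test :: "nat \<Rightarrow> ((nat \<Rightarrow> real) \<Rightarrow> bool) \<Rightarrow> bool" where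
  "is_test N \<phi> \<longleftrightarrow> \<phi> \<in> (\<Pi>\<^sub>M i\<in>{1..N}. circle_measure) \<rightarrow>\<^sub>M count_space UNIV"

definition p_fa :: "nat \<Rightarrow> ((nat \<Rightarrow> real) \<Rightarrow> bool) \<Rightarrow> real" where
  "p_fa N \<phi> = \<P>(X in null_law N. \<phi> X)"

definition p_miss :: "nat \<Rightarrow> nat \<Rightarrow> real \<Rightarrow> ((nat \<Rightarrow> real) \<Rightarrow> bool) \<Rightarrow> real" where
  "p_miss N K \<kappa> \<phi> = \<P>(X in planted_law N K \<kappa>. \<not> \<phi> X)"

text \<open>Strong detection, achieved by a given sequence of tests.\<close>

definition strong_detection_with ::
  "(nat \<Rightarrow> nat) \<Rightarrow> (nat \<Rightarrow> real) \<Rightarrow> (nat \<Rightarrow> (nat \<Rightarrow> real) \<Rightarrow> bool) \<Rightarrow> bool" where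
  "strong_detection_with K \<kappa> \<phi> \<longleftrightarrow>
     (\<forall>N. is_test N (\<phi> N)) \<and>
     (\<lambda>N. p_fa N (\<phi> N)) \<longlonglongrightarrow> 0 \<and>
     (\<lambda>N. p_miss N (K N) (\<kappa> N) (\<phi> N)) \<longlonglongrightarrow> 0"

definition interval_test :: "nat \<Rightarrow> real \<Rightarrow> real \<Rightarrow> (nat \<Rightarrow> real) \<Rightarrow> bool" where
  "interval_test N \<tau> \<gamma> X \<longleftrightarrow>
     (SUP \<theta>\<in>{0..<2 * pi}. \<Sum>i=1..N. indicat_real (circle_arc \<theta> (\<theta> + 2 * pi * \<tau>)) (X i)) \<ge> \<gamma>"

definition von_mises_prob :: "real \<Rightarrow> real \<Rightarrow> real" where
  "von_mises_prob \<kappa> \<tau> = \<P>(x in von_mises 0 \<kappa>. x \<in> circle_arc (- pi * \<tau>) (pi * \<tau>))"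

definition window_gain :: "nat \<Rightarrow> real \<Rightarrow> real \<Rightarrow> real" where
  "window_gain K \<kappa> \<tau> = real K * (von_mises_prob \<kappa> \<tau> - \<tau>)"

definition interval_threshold :: "nat \<Rightarrow> nat \<Rightarrow> real \<Rightarrow> real \<Rightarrow> real \<Rightarrow> real" where
  "interval_threshold N K \<kappa> \<tau> c =
     real N * \<tau> + window_gain K \<kappa> \<tau> - c * sqrt (real N * \<tau> + window_gain K \<kappa> \<tau>)"

definition gaussian_Q :: "real \<Rightarrow> real" where
  "gaussian_Q x = measure std_normal_distribution {x<..}"

definition window_cost :: "real \<Rightarrow> real" where
  "window_cost c = c / (1 - 2 * gaussian_Q c)\<^sup>2"

definition critical_const :: real where
  "critical_const = 2 / pi * (INF c\<in>{0<..}. window_cost c)"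

text \<open>Subset sizes are integers, so \<open>K = N\<^sup>\<alpha>\<close> is read up to rounding, in either direction
  and possibly depending on \<open>N\<close>.\<close>

definition power_size :: "(nat \<Rightarrow> nat) \<Rightarrow> real \<Rightarrow> bool" where
  "power_size K \<alpha> \<longleftrightarrow>
     (\<forall>N. int (K N) = \<lfloor>real N powr \<alpha>\<rfloor> \<or> int (K N) = \<lceil>real N powr \<alpha>\<rceil>)"

end

theory Submission
  imports Defs "HOL-Real_Asymp.Real_Asymp"
begin

text \<open>
The test statistic is the largest number of observations in an arc of length \<open>2\<pi>\<tau>\<close>. Sliding an
arc forward until its left end point hits an observation loses none of the observations in it,
so the supremum over all arcs is a maximum over the \<open>N\<close> arcs that start at an observation. This
makes the test measurable and, more importantly, reduces the false alarm probability to a union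
bound over \<open>N\<close> events. Under the null hypothesis the number of points in the arc starting at
\<open>X\<^sub>j\<close> is, given \<open>X\<^sub>j\<close>, one plus a binomial variable with parameters \<open>N - 1\<close> and \<open>\<tau>\<close>.

Write \<open>\<lambda> = N\<tau>\<close> and \<open>\<mu> = \<lambda> + g\<close>, so that the threshold is \<open>\<mu> - c\<surd>\<mu> = \<lambda> + t\<close> with
\<open>t = g - c\<surd>\<mu>\<close>. The exponential moment of a sum of independent indicators with total mean \<open>m\<close> is at
most \<open>exp ((e\<^sup>s - 1) m)\<close>. For the planted law, the arc of length \<open>2\<pi>\<tau>\<close> centred at the phase
contains \<open>\<mu>\<close> points on average, and the lower Chernoff bound gives a miss probability of at most
\<open>exp (- c\<^sup>2 / 2)\<close>. For the null law with \<open>t / \<lambda> \<rightarrow> 0\<close>, the upper Chernoff bound together with the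
union bound gives about \<open>N exp (- t\<^sup>2 / (2\<lambda>))\<close>. Hence, with \<open>c \<rightarrow> \<infinity>\<close>, the test
succeeds as soon as \<open>t \<ge> \<rho> sqrt (2 \<lambda> log N)\<close> for some \<open>\<rho> > 1\<close>. This is the criterion \<open>interval_test_detects\<close>,
from which both regimes follow.

For \<open>\<alpha> \<le> 1/2\<close> the concentration \<open>\<kappa>\<close> tends to infinity, and by Laplace's method the von Mises law
at scale \<open>1/\<surd>\<kappa>\<close> becomes a standard Gaussian (\<open>von_mises_prob_limit\<close>). So \<open>g / K\<close> tends to
\<open>q = 1 - 2 Q(c\<^sub>2)\<close>, while \<open>\<lambda> log N = a K\<^sup>2\<close> with \<open>a = c\<^sub>2 / (\<pi> c\<^sub>1)\<close>. The criterion becomes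
\<open>q > sqrt (2 a)\<close>, that is \<open>c\<^sub>1 > (2/\<pi>) c\<^sub>2 / q\<^sup>2\<close>; minimising the right-hand side over \<open>c\<^sub>2\<close> is what
produces the critical constant.

For \<open>\<alpha> > 1/2\<close> a concentration bounded away from zero gives every window of proportion
\<open>\<tau> \<in> [\<epsilon>, 1 - \<epsilon>]\<close> a gain \<open>p\<^sub>\<kappa>(\<tau>) - \<tau>\<close> that is bounded below (\<open>von_mises_prob_gain\<close>), so \<open>t\<close> is of order
\<open>K\<close>, which dominates \<open>sqrt (N log N)\<close>.
\<close>

section \<open>Arcs and the scan statistic\<close>

text \<open>The fractional part measures the forward distance from \<open>a\<close> to \<open>x\<close> along the circle. This form
of arc membership replaces the existential quantifier over integers, and is visibly measurable
in \<open>x\<close> and \<open>a\<close> jointly.\<close>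
lemma circle_arc_iff_frac:
  "x \<in> circle_arc a (a + w) \<longleftrightarrow> 2 * pi * frac ((x - a) / (2 * pi)) \<le> w"
proof
  assume "x \<in> circle_arc a (a + w)"
  then obtain k :: int where k: "a \<le> x + 2 * pi * of_int k" "x + 2 * pi * of_int k \<le> a + w"
    by (auto simp: circle_arc_def)
  define y where "y = (x - a) / (2 * pi) + of_int k"
  have y: "2 * pi * y = x - a + 2 * pi * of_int k"
    by (simp add: y_def field_simps)
  have "0 \<le> y"
    using k(1) y by (metis diff_add_eq diff_ge_0_iff_ge pi_gt_zero zero_le_mult_iff
        mult_pos_pos zero_less_numeral not_le)
  then have "frac y \<le> y"
    by (simp add: frac_def)
  then have "2 * pi * frac y \<le> 2 * pi * y"
    by simp
  also have "\<dots> \<le> w"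
    using k(2) y by simp
  finally show "2 * pi * frac ((x - a) / (2 * pi)) \<le> w"
    by (simp add: y_def)
next
  assume *: "2 * pi * frac ((x - a) / (2 * pi)) \<le> w"
  have eq: "x + 2 * pi * of_int (- \<lfloor>(x - a) / (2 * pi)\<rfloor>) = a + 2 * pi * frac ((x - a) / (2 * pi))"
    by (simp only: frac_def right_diff_distrib) simp
  have "0 \<le> 2 * pi * frac ((x - a) / (2 * pi))"
    by simp
  with * eq show "x \<in> circle_arc a (a + w)"
    unfolding circle_arc_def by (intro CollectI exI[of _ "- \<lfloor>(x - a) / (2 * pi)\<rfloor>"]) auto
qed

definition arc_count :: "nat \<Rightarrow> real \<Rightarrow> (nat \<Rightarrow> real) \<Rightarrow> real \<Rightarrow> real" where
  "arc_count N w X \<theta> = (\<Sum>i=1..N. indicat_real (circle_arc \<theta> (\<theta> + w)) (X i))"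

lemma arc_count_in_range: "arc_count N w X \<theta> \<in> real ` {..N}"
proof -
  have "arc_count N w X \<theta> = real (card {i\<in>{1..N}. X i \<in> circle_arc \<theta> (\<theta> + w)})"
    unfolding arc_count_def indicator_def
    by (simp add: of_bool_def flip: sum.inter_filter)
  moreover have "card {i\<in>{1..N}. X i \<in> circle_arc \<theta> (\<theta> + w)} \<le> card {1..N}"
    by (intro card_mono) auto
  ultimately show ?thesis by auto
qed

lemma circle_arc_cong:
  assumes "a' = a + 2 * pi * of_int k"
  shows "circle_arc a' (a' + w) = circle_arc a (a + w)"
proof -
  have "(x - a') / (2 * pi) = (x - a) / (2 * pi) + of_int (- k)" for x
    using assms by (simp add: field_simps)
  then show ?thesis
    by (auto simp: circle_arc_iff_frac simp del: of_int_minus)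
qed

text \<open>Take the observation \<open>X\<^sub>j\<close> at the smallest forward distance from \<open>\<theta>\<close>. Every other forward distance
shrinks by that amount when the arc is moved to start at \<open>X\<^sub>j\<close>, so no point leaves the arc.\<close>
lemma arc_count_shift_to_data:
  assumes "N \<ge> 1"
  obtains j where "j \<in> {1..N}" "arc_count N w X \<theta> \<le> arc_count N w X (X j)"
proof -
  define d where "d i = frac ((X i - \<theta>) / (2 * pi))" for i
  obtain j where j: "j \<in> {1..N}" "\<And>i. i \<in> {1..N} \<Longrightarrow> d j \<le> d i"
    using assms arg_min_if_finite[of "{1..N}" d] by (metis arg_min_least atLeastAtMost_iff finite_atLeastAtMost order_refl empty_iff)
  have "indicat_real (circle_arc \<theta> (\<theta> + w)) (X i) \<le> indicat_real (circle_arc (X j) (X j + w)) (X i)"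
    if i: "i \<in> {1..N}" for i
  proof -
    have "(X i - X j) / (2 * pi) = (X i - \<theta>) / (2 * pi) - (X j - \<theta>) / (2 * pi)"
      by (simp add: field_simps)
    then have "frac ((X i - X j) / (2 * pi)) = d i - d j"
      using frac_diff_pos[of "(X j - \<theta>) / (2 * pi)" "(X i - \<theta>) / (2 * pi)"] j(2)[OF i]
      by (simp add: d_def)
    also have "\<dots> \<le> d i"
      by (simp add: d_def)
    finally have "2 * pi * frac ((X i - X j) / (2 * pi)) \<le> 2 * pi * d i"
      by simp
    then have "2 * pi * d i \<le> w \<Longrightarrow> 2 * pi * frac ((X i - X j) / (2 * pi)) \<le> w"
      by linarith
    then show ?thesis
      by (auto simp: indicator_def circle_arc_iff_frac d_def)
  qed
  then have "arc_count N w X \<theta> \<le> arc_count N w X (X j)"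
    unfolding arc_count_def by (intro sum_mono) auto
  with j(1) show thesis by (rule that)
qed

text \<open>Here \<open>\<theta>\<close> is an arbitrary real, as is needed for the arc centred at the phase, whose left end
may be negative.\<close>
lemma arc_count_le_SUP:
  "arc_count N w X \<theta> \<le> (SUP \<theta>\<in>{0..<2 * pi}. arc_count N w X \<theta>)"
proof -
  \<comment> \<open>the representative of \<open>\<theta>\<close> in \<open>[0, 2\<pi>)\<close> gives the same arc\<close>
  define \<theta>' where "\<theta>' = 2 * pi * frac (\<theta> / (2 * pi))"
  have eq: "\<theta>' = \<theta> + 2 * pi * of_int (- \<lfloor>\<theta> / (2 * pi)\<rfloor>)"
    by (simp add: \<theta>'_def frac_def right_diff_distrib)
  have "\<theta>' \<in> {0..<2 * pi}"
    by (auto simp: \<theta>'_def frac_lt_1)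
  moreover have "bdd_above (arc_count N w X ` {0..<2 * pi})"
  proof (rule bdd_aboveI2)
    show "arc_count N w X x \<le> real N" for x
      using arc_count_in_range[of N w X x] by auto
  qed
  ultimately have "arc_count N w X \<theta>' \<le> (SUP \<theta>\<in>{0..<2 * pi}. arc_count N w X \<theta>)"
    by (rule cSUP_upper)
  then show ?thesis
    using circle_arc_cong[OF eq] by (simp add: arc_count_def)
qed

lemma SUP_arc_count_attained:
  obtains \<theta> where "\<theta> \<in> {0..<2 * pi}" "(SUP \<theta>\<in>{0..<2 * pi}. arc_count N w X \<theta>) = arc_count N w X \<theta>"
proof -
  let ?A = "arc_count N w X ` {0..<2 * pi}"
  have "finite ?A"
    by (rule finite_subset[of _ "real ` {..N}"]) (auto intro: arc_count_in_range)
  moreover have "?A \<noteq> {}"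
    by simp
  ultimately have "Sup ?A \<in> ?A"
    using Max_in by (metis cSup_eq_Max)
  then show thesis
    using that by auto
qed

lemma interval_test_iff_data:
  assumes "N \<ge> 1"
  shows "interval_test N \<tau> \<gamma> X \<longleftrightarrow> (\<exists>j\<in>{1..N}. \<gamma> \<le> arc_count N (2 * pi * \<tau>) X (X j))"
proof -
  have eq: "interval_test N \<tau> \<gamma> X \<longleftrightarrow> \<gamma> \<le> (SUP \<theta>\<in>{0..<2 * pi}. arc_count N (2 * pi * \<tau>) X \<theta>)"
    by (simp add: interval_test_def arc_count_def)
  show ?thesis
    unfolding eq
    by (metis SUP_arc_count_attained arc_count_shift_to_data[OF assms] arc_count_le_SUP order_trans)
qed

lemma borel_measurable_frac [measurable]: "(frac :: real \<Rightarrow> real) \<in> borel_measurable borel"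
  unfolding frac_def by measurable

lemma indicator_circle_arc_measurable [measurable (raw)]:
  assumes [measurable]: "f \<in> borel_measurable M" "g \<in> borel_measurable M"
  shows "(\<lambda>x. indicat_real (circle_arc (g x) (g x + w)) (f x)) \<in> borel_measurable M"
  unfolding indicator_def circle_arc_iff_frac by measurable

lemma circle_arc_in_borel [measurable]: "circle_arc a b \<in> sets borel"
proof -
  have "circle_arc a (a + (b - a)) = {x. 2 * pi * frac ((x - a) / (2 * pi)) \<le> b - a}"
    by (auto simp only: circle_arc_iff_frac)
  also have "\<dots> \<in> sets borel"
    by measurable
  finally show ?thesis by simp
qed

lemma borel_measurable_circle: "f \<in> borel_measurable borel \<Longrightarrow> f \<in> borel_measurable circle_measure"
  unfolding circle_measure_def by (intro measurable_restrict_space1) simp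

lemma coordinate_measurable:
  assumes "\<And>i. i \<in> I \<Longrightarrow> sets (M i) = sets circle_measure" "i \<in> I"
  shows "(\<lambda>X. X i) \<in> borel_measurable (PiM I M)"
proof -
  have "(\<lambda>x. x) \<in> M i \<rightarrow>\<^sub>M borel"
    using borel_measurable_circle[of "\<lambda>x. x"] assms by (simp cong: measurable_cong_sets)
  from measurable_compose[OF measurable_component_singleton[OF assms(2), of M] this] show ?thesis .
qed

lemma arc_count_measurable:
  assumes "\<And>i. sets (M i) = sets circle_measure"
  shows "(\<lambda>X. arc_count N w X \<theta>) \<in> borel_measurable (PiM {1..N} M)"
    and "j \<in> {1..N} \<Longrightarrow> (\<lambda>X. arc_count N w X (X j)) \<in> borel_measurable (PiM {1..N} M)"
  unfolding arc_count_def
  by (intro borel_measurable_sum indicator_circle_arc_measurable coordinate_measurable assms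
      borel_measurable_const; simp)+

lemma interval_test_measurable:
  assumes sets: "\<And>i. sets (M i) = sets circle_measure"
  shows "Measurable.pred (PiM {1..N} M) (interval_test N \<tau> \<gamma>)"
proof (cases "N \<ge> 1")
  case True
  have pred: "Measurable.pred (PiM {1..N} M) (\<lambda>X. \<gamma> \<le> arc_count N (2 * pi * \<tau>) X (X j))"
    if "j \<in> {1..N}" for j
    using arc_count_measurable(2)[OF sets that] by measurable
  have "Measurable.pred (PiM {1..N} M) (\<lambda>X. \<exists>j\<in>{1..N}. \<gamma> \<le> arc_count N (2 * pi * \<tau>) X (X j))"
    by (rule pred_intros_finite(4)[OF finite_atLeastAtMost pred])
  then show ?thesis
    by (simp add: interval_test_iff_data[OF True, abs_def])
next
  case False
  then show ?thesis
    by (simp add: interval_test_def[abs_def])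
qed

lemma is_test_interval_test: "is_test N (interval_test N \<tau> \<gamma>)"
  unfolding is_test_def by (rule interval_test_measurable) simp

section \<open>Integration on the circle\<close>

lemma nn_integral_circle:
  fixes f :: "real \<Rightarrow> ennreal"
  shows "(\<integral>\<^sup>+x. f x \<partial>circle_measure) = (\<integral>\<^sup>+x. f x * indicator {0..<2 * pi} x \<partial>lborel)"
  unfolding circle_measure_def by (subst nn_integral_restrict_space) auto

lemma space_circle [simp]: "space circle_measure = {0..<2 * pi}"
  by (simp add: circle_measure_def space_restrict_space)

lemma periodic_of_int:
  fixes f :: "real \<Rightarrow> 'a"
  assumes per: "\<And>x. f (x + 2 * pi) = f x"
  shows "f (x + 2 * pi * of_int k) = f x"
proof -
  have nat: "f (x + 2 * pi * of_nat n) = f x" for x n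
  proof (induction n)
    case (Suc n)
    have "x + 2 * pi * of_nat (Suc n) = (x + 2 * pi * of_nat n) + 2 * pi"
      by (simp add: algebra_simps)
    then show ?case
      using per Suc by metis
  qed simp
  show ?thesis
  proof (cases "k \<ge> 0")
    case True
    then show ?thesis
      using nat[of x "nat k"] by simp
  next
    case False
    then show ?thesis
      using nat[of "x + 2 * pi * of_int k" "nat (- k)"] by simp
  qed
qed

text \<open>After reducing the rotation angle to \<open>\<theta> \<in> [0, 2\<pi>)\<close>, the substitution maps \<open>[0, 2\<pi>)\<close> to
\<open>[-\<theta>, 2\<pi> - \<theta>)\<close>, and periodicity moves the part left of \<open>0\<close> back to \<open>[2\<pi> - \<theta>, 2\<pi>)\<close>.\<close>
lemma nn_integral_circle_rotate:
  fixes f :: "real \<Rightarrow> ennreal"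
  assumes [measurable]: "f \<in> borel_measurable borel" and per: "\<And>x. f (x + 2 * pi) = f x"
  shows "(\<integral>\<^sup>+x. f (x - \<Theta>) \<partial>circle_measure) = (\<integral>\<^sup>+x. f x \<partial>circle_measure)"
proof -
  define \<theta> where "\<theta> = 2 * pi * frac (\<Theta> / (2 * pi))"
  have "\<theta> = \<Theta> - 2 * pi * of_int \<lfloor>\<Theta> / (2 * pi)\<rfloor>"
    unfolding \<theta>_def frac_def right_diff_distrib by simp
  then have eq: "f (x - \<Theta>) = f (x - \<theta>)" for x
    using periodic_of_int[of f "x - \<Theta>" "\<lfloor>\<Theta> / (2 * pi)\<rfloor>", OF per]
    by (metis diff_diff_eq2 add_diff_eq diff_add_eq)
  have \<theta>: "0 \<le> \<theta>" "\<theta> < 2 * pi"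
    by (auto simp: \<theta>_def frac_lt_1)
  have "(\<integral>\<^sup>+x. f (x - \<Theta>) \<partial>circle_measure)
      = (\<integral>\<^sup>+x. f (x - \<theta>) * indicator {0..<2 * pi} x \<partial>lborel)"
    by (simp add: eq nn_integral_circle)
  also have "\<dots> = (\<integral>\<^sup>+x. f x * indicator {0..<2 * pi} (\<theta> + x) \<partial>lborel)"
    by (subst nn_integral_real_affine[where c = 1 and t = \<theta>]) auto
  also have "\<dots> = (\<integral>\<^sup>+x. f x * indicator {-\<theta>..<0} x + f x * indicator {0..<2 * pi - \<theta>} x \<partial>lborel)"
    using \<theta> by (intro nn_integral_cong) (auto simp: indicator_def)
  also have "\<dots> = (\<integral>\<^sup>+x. f x * indicator {-\<theta>..<0} x \<partial>lborel)
      + (\<integral>\<^sup>+x. f x * indicator {0..<2 * pi - \<theta>} x \<partial>lborel)"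
    by (intro nn_integral_add) auto
  also have "(\<integral>\<^sup>+x. f x * indicator {-\<theta>..<0} x \<partial>lborel)
      = (\<integral>\<^sup>+x. f (- 2 * pi + x) * indicator {-\<theta>..<0} (- 2 * pi + x) \<partial>lborel)"
    by (subst nn_integral_real_affine[where c = 1 and t = "- 2 * pi"]) auto
  also have "\<dots> = (\<integral>\<^sup>+x. f x * indicator {2 * pi - \<theta>..<2 * pi} x \<partial>lborel)"
  proof (intro nn_integral_cong)
    fix x
    have "f (- 2 * pi + x) = f x"
      using per[of "- 2 * pi + x"] by simp
    then show "f (- 2 * pi + x) * indicator {-\<theta>..<0} (- 2 * pi + x)
        = f x * indicator {2 * pi - \<theta>..<2 * pi} x"
      by (auto simp: indicator_def)
  qed
  also have "\<dots> + (\<integral>\<^sup>+x. f x * indicator {0..<2 * pi - \<theta>} x \<partial>lborel)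
      = (\<integral>\<^sup>+x. f x * indicator {2 * pi - \<theta>..<2 * pi} x + f x * indicator {0..<2 * pi - \<theta>} x \<partial>lborel)"
    by (intro nn_integral_add[symmetric]) auto
  also have "\<dots> = (\<integral>\<^sup>+x. f x * indicator {0..<2 * pi} x \<partial>lborel)"
    using \<theta> by (intro nn_integral_cong) (auto simp: indicator_def)
  finally show ?thesis
    by (simp add: nn_integral_circle)
qed

lemma nn_integral_circle_window:
  fixes f :: "real \<Rightarrow> ennreal"
  assumes [measurable]: "f \<in> borel_measurable borel" and per: "\<And>x. f (x + 2 * pi) = f x"
  shows "(\<integral>\<^sup>+x. f x \<partial>circle_measure) = (\<integral>\<^sup>+x. f x * indicator {a..<a + 2 * pi} x \<partial>lborel)"
proof -
  have "(\<integral>\<^sup>+x. f x * indicator {a..<a + 2 * pi} x \<partial>lborel)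
      = (\<integral>\<^sup>+x. f (a + x) * indicator {0..<2 * pi} x \<partial>lborel)"
    by (subst nn_integral_real_affine[where c = 1 and t = a])
      (auto intro!: nn_integral_cong simp: indicator_def)
  also have "\<dots> = (\<integral>\<^sup>+x. f (x - (- a)) \<partial>circle_measure)"
    by (simp add: nn_integral_circle add.commute)
  also have "\<dots> = (\<integral>\<^sup>+x. f x \<partial>circle_measure)"
    by (rule nn_integral_circle_rotate[OF assms])
  finally show ?thesis by simp
qed

lemma indicator_arc_translate:
  "indicator (circle_arc (a + b) (a + b + w)) x = (indicator (circle_arc b (b + w)) (x - a) :: 'a :: zero_neq_one)"
  unfolding indicator_def circle_arc_iff_frac by (simp add: diff_diff_eq)

lemma indicator_arc_periodic:
  "indicator (circle_arc a b) (x + 2 * pi) = (indicator (circle_arc a b) x :: 'a :: zero_neq_one)"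
proof -
  have "(x + 2 * pi - a) / (2 * pi) = (x - a) / (2 * pi) + of_int 1"
    by (simp add: field_simps)
  then have "x + 2 * pi \<in> circle_arc a (a + (b - a)) \<longleftrightarrow> x \<in> circle_arc a (a + (b - a))"
    unfolding circle_arc_iff_frac by (metis frac_add_of_int_right)
  then show ?thesis
    by (simp add: indicator_def)
qed

lemma sets_uniform_angle [simp, measurable_cong]: "sets uniform_angle = sets circle_measure"
  by (simp add: uniform_angle_def)

lemma sets_von_mises [simp, measurable_cong]: "sets (von_mises \<Theta> \<kappa>) = sets circle_measure"
  by (simp add: von_mises_def)

lemma space_uniform_angle [simp]: "space uniform_angle = {0..<2 * pi}"
  by (simp add: uniform_angle_def)

lemma space_von_mises [simp]: "space (von_mises \<Theta> \<kappa>) = {0..<2 * pi}"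
  by (simp add: von_mises_def)

lemma emeasure_circle_space: "emeasure circle_measure {0..<2 * pi} = ennreal (2 * pi)"
  unfolding circle_measure_def by (subst emeasure_restrict_space) auto

lemma sets_circle_Collect [measurable]:
  "A \<in> sets borel \<Longrightarrow> {x \<in> {0..<2 * pi}. x \<in> A} \<in> sets circle_measure"
  unfolding circle_measure_def by (auto simp: sets_restrict_space image_iff)

lemma prob_space_uniform_angle: "prob_space uniform_angle"
  unfolding uniform_angle_def
  by (rule prob_space_uniform_measure) (simp_all add: emeasure_circle_space ennreal_eq_0_iff not_le)

lemma uniform_angle_arc:
  assumes "0 \<le> \<tau>" "\<tau> < 1"
  shows "measure uniform_angle {x \<in> space uniform_angle. x \<in> circle_arc a (a + 2 * pi * \<tau>)} = \<tau>"
proof -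
  have *: "x \<in> circle_arc 0 (0 + 2 * pi * \<tau>) \<longleftrightarrow> x \<le> 2 * pi * \<tau>" if "0 \<le> x" "x < 2 * pi" for x
  proof -
    have "frac (x / (2 * pi)) = x / (2 * pi)"
      using that by (simp add: frac_eq)
    then show ?thesis
      unfolding circle_arc_iff_frac by simp
  qed
  have lt: "x < 2 * pi" if "x \<le> 2 * pi * \<tau>" for x
    using that assms(2) by (smt (verit) mult_less_cancel_left_pos mult_cancel_left1 pi_gt_zero mult_less_cancel_left2)
  have "emeasure circle_measure {x \<in> {0..<2 * pi}. x \<in> circle_arc a (a + 2 * pi * \<tau>)}
      = (\<integral>\<^sup>+x. indicator (circle_arc a (a + 2 * pi * \<tau>)) x \<partial>circle_measure)"
    by (subst nn_integral_indicator[symmetric, OF sets_circle_Collect[OF circle_arc_in_borel]])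
      (auto intro!: nn_integral_cong simp: indicator_def simp del: nn_integral_indicator)
  also have "\<dots> = (\<integral>\<^sup>+x. indicator (circle_arc 0 (0 + 2 * pi * \<tau>)) (x - a) \<partial>circle_measure)"
    using indicator_arc_translate[of a 0 "2 * pi * \<tau>"] by (intro nn_integral_cong) simp
  also have "\<dots> = (\<integral>\<^sup>+x. indicator (circle_arc 0 (0 + 2 * pi * \<tau>)) x \<partial>circle_measure)"
    by (rule nn_integral_circle_rotate) (auto simp: indicator_arc_periodic)
  also have "\<dots> = (\<integral>\<^sup>+x. indicator {0..2 * pi * \<tau>} x \<partial>lborel)"
    unfolding nn_integral_circle using lt * by (intro nn_integral_cong) (auto simp: indicator_def)
  also have "\<dots> = ennreal (2 * pi * \<tau>)"
    using assms(1) by simp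
  finally have e: "emeasure circle_measure {x \<in> {0..<2 * pi}. x \<in> circle_arc a (a + 2 * pi * \<tau>)}
      = ennreal (2 * pi * \<tau>)" .
  have "emeasure uniform_angle {x \<in> {0..<2 * pi}. x \<in> circle_arc a (a + 2 * pi * \<tau>)}
      = ennreal (2 * pi * \<tau>) / ennreal (2 * pi)"
  proof -
    have "{0..<2 * pi} \<in> sets circle_measure"
      using sets.top[of circle_measure] by simp
    moreover have "{0..<2 * pi} \<inter> {x \<in> {0..<2 * pi}. x \<in> circle_arc a (a + 2 * pi * \<tau>)}
        = {x \<in> {0..<2 * pi}. x \<in> circle_arc a (a + 2 * pi * \<tau>)}"
      by auto
    ultimately show ?thesis
      unfolding uniform_angle_def
      by (simp only: emeasure_uniform_measure sets_circle_Collect[OF circle_arc_in_borel] e emeasure_circle_space)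
  qed
  also have "\<dots> = ennreal \<tau>"
    using assms(1) by (subst divide_ennreal) auto
  finally show ?thesis
    using assms(1) by (simp add: measure_def)
qed

lemma continuous_exp_cos: "continuous_on A (\<lambda>u. exp (\<kappa> * cos u :: real))"
  by (intro continuous_intros)

lemma integrable_exp_cos: fixes a b \<kappa> :: real
  shows "set_integrable lborel {a..b} (\<lambda>u. exp (\<kappa> * cos u :: real))"
  using borel_integrable_compact[of "{a..b}" "\<lambda>u. exp (\<kappa> * cos u)"] continuous_exp_cos
  unfolding set_integrable_def by (simp add: indicator_scaleR_eq_if)

text \<open>The half-open interval on the right is the form in which integrals over the circle appear.\<close>
lemma exp_cos_integral:
  fixes a b \<kappa> :: real
  shows
  "ennreal (LINT u:{a..b}|lborel. exp (\<kappa> * cos u))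
    = (\<integral>\<^sup>+u. ennreal (exp (\<kappa> * cos u)) * indicator {a..<b} u \<partial>lborel)"
proof -
  have "ennreal (LINT u:{a..b}|lborel. exp (\<kappa> * cos u))
      = (\<integral>\<^sup>+u. ennreal (indicat_real {a..b} u * exp (\<kappa> * cos u)) \<partial>lborel)"
    using integrable_exp_cos[of a b \<kappa>] unfolding set_lebesgue_integral_def set_integrable_def
    by (subst nn_integral_eq_integral) auto
  also have "\<dots> = (\<integral>\<^sup>+u. ennreal (exp (\<kappa> * cos u)) * indicator {a..<b} u \<partial>lborel)"
  proof (rule nn_integral_cong_AE)
    show "AE u in lborel. ennreal (indicat_real {a..b} u * exp (\<kappa> * cos u))
        = ennreal (exp (\<kappa> * cos u)) * indicator {a..<b} u"
      using AE_lborel_singleton[of b] by eventually_elim (auto simp: indicator_def)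
  qed
  finally show ?thesis .
qed

lemma exp_cos_integral_pos:
  fixes a b \<kappa> :: real
  assumes "a < b"
  shows "0 < (LINT u:{a..b}|lborel. exp (\<kappa> * cos u))"
proof -
  have "0 < (b - a) * exp (- \<bar>\<kappa>\<bar>)"
    using assms by simp
  also have "\<dots> = (LINT u:{a..b}|lborel. exp (- \<bar>\<kappa>\<bar>))"
    using assms by (simp add: set_lebesgue_integral_def)
  also have "\<dots> \<le> (LINT u:{a..b}|lborel. exp (\<kappa> * cos u))"
  proof (rule set_integral_mono)
    show "exp (- \<bar>\<kappa>\<bar>) \<le> exp (\<kappa> * cos u)" for u
    proof -
      have "\<bar>\<kappa> * cos u\<bar> \<le> \<bar>\<kappa>\<bar>"
        by (simp add: abs_mult mult_left_le)
      then show ?thesis by simp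
    qed
  qed (use integrable_exp_cos[of a b 0] integrable_exp_cos[of a b \<kappa>] in \<open>auto simp: set_integrable_def\<close>)
  finally show ?thesis .
qed

abbreviation exp_cos_total :: "real \<Rightarrow> real" where
  "exp_cos_total \<kappa> \<equiv> LINT u:{- pi..pi}|lborel. exp (\<kappa> * cos u)"

lemma exp_cos_total_circle: "(\<integral>\<^sup>+x. ennreal (exp (\<kappa> * cos x)) \<partial>circle_measure) = ennreal (exp_cos_total \<kappa>)"
  unfolding exp_cos_integral
  by (subst nn_integral_circle_window[where a = "- pi"]) auto

text \<open>The normalising constant is most convenient as an integral over the window \<open>[-\<pi>, \<pi>]\<close> that is
symmetric about the mode.\<close>
lemma bessel_I0_eq: "2 * pi * bessel_I0 \<kappa> = exp_cos_total \<kappa>"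
proof -
  have "ennreal (2 * pi * bessel_I0 \<kappa>) = ennreal (exp_cos_total \<kappa>)"
    unfolding exp_cos_total_circle[symmetric] bessel_I0_def nn_integral_circle
    by (simp add: exp_cos_integral)
  moreover have "0 \<le> 2 * pi * bessel_I0 \<kappa>"
    using exp_cos_integral_pos[of 0 "2 * pi" \<kappa>] by (simp add: bessel_I0_def)
  moreover have "0 \<le> exp_cos_total \<kappa>"
    using exp_cos_integral_pos[of "- pi" pi \<kappa>] by simp
  ultimately show ?thesis by simp
qed

lemma exp_cos_total_pos: "0 < exp_cos_total \<kappa>"
  using exp_cos_integral_pos[of "- pi" pi \<kappa>] by simp

lemma emeasure_von_mises:
  assumes "A \<in> sets borel"
  shows "emeasure (von_mises \<Theta> \<kappa>) {x \<in> {0..<2 * pi}. x \<in> A}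
    = (\<integral>\<^sup>+x. ennreal (1 / exp_cos_total \<kappa> * exp (\<kappa> * cos (x - \<Theta>))) * indicator A x \<partial>circle_measure)"
  unfolding von_mises_def bessel_I0_eq using assms
  by (subst emeasure_density)
    (auto intro!: nn_integral_cong borel_measurable_circle sets_circle_Collect[simplified] simp: indicator_def)

lemma prob_space_von_mises: "prob_space (von_mises \<Theta> \<kappa>)"
proof (rule prob_spaceI)
  have "emeasure (von_mises \<Theta> \<kappa>) (space (von_mises \<Theta> \<kappa>))
      = (\<integral>\<^sup>+x. ennreal (1 / exp_cos_total \<kappa> * exp (\<kappa> * cos (x - \<Theta>))) \<partial>circle_measure)"
    using emeasure_von_mises[of UNIV \<Theta> \<kappa>] by (simp add: atLeastLessThan_def atLeast_def lessThan_def Int_def)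
  also have "\<dots> = (\<integral>\<^sup>+x. ennreal (1 / exp_cos_total \<kappa> * exp (\<kappa> * cos x)) \<partial>circle_measure)"
    by (rule nn_integral_circle_rotate[where f = "\<lambda>x. ennreal (1 / exp_cos_total \<kappa> * exp (\<kappa> * cos x))"]) auto
  also have "\<dots> = (\<integral>\<^sup>+x. ennreal (1 / exp_cos_total \<kappa>) * ennreal (exp (\<kappa> * cos x)) \<partial>circle_measure)"
    using exp_cos_total_pos[of \<kappa>] by (intro nn_integral_cong ennreal_mult) auto
  also have "\<dots> = ennreal (1 / exp_cos_total \<kappa>) * ennreal (exp_cos_total \<kappa>)"
    unfolding exp_cos_total_circle[symmetric]
    by (intro nn_integral_cmult borel_measurable_circle) auto
  also have "\<dots> = 1"
    using exp_cos_total_pos[of \<kappa>] by (simp add: ennreal_mult'[symmetric])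
  finally show "emeasure (von_mises \<Theta> \<kappa>) (space (von_mises \<Theta> \<kappa>)) = 1" .
qed

text \<open>By rotation invariance, the arc centred at the phase carries the same mass for every phase.\<close>
lemma von_mises_arc:
  "measure (von_mises \<Theta> \<kappa>) {x \<in> space (von_mises \<Theta> \<kappa>). x \<in> circle_arc (\<Theta> - pi * \<tau>) (\<Theta> - pi * \<tau> + 2 * pi * \<tau>)}
    = von_mises_prob \<kappa> \<tau>"
proof -
  define f :: "real \<Rightarrow> ennreal" where
    "f x = ennreal (1 / exp_cos_total \<kappa> * exp (\<kappa> * cos x)) * indicator (circle_arc (- pi * \<tau>) (pi * \<tau>)) x" for x
  have [measurable]: "f \<in> borel_measurable borel"
    unfolding f_def by measurable
  have "indicator (circle_arc (\<Theta> - pi * \<tau>) (\<Theta> - pi * \<tau> + 2 * pi * \<tau>)) x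
      = (indicator (circle_arc (- pi * \<tau>) (pi * \<tau>)) (x - \<Theta>) :: ennreal)" for x
    using indicator_arc_translate[of \<Theta> "- pi * \<tau>" "2 * pi * \<tau>" x] by simp
  then have "emeasure (von_mises \<Theta> \<kappa>) {x \<in> {0..<2 * pi}. x \<in> circle_arc (\<Theta> - pi * \<tau>) (\<Theta> - pi * \<tau> + 2 * pi * \<tau>)}
      = (\<integral>\<^sup>+x. f (x - \<Theta>) \<partial>circle_measure)"
    by (subst emeasure_von_mises) (simp_all add: f_def)
  also have "\<dots> = (\<integral>\<^sup>+x. f x \<partial>circle_measure)"
    by (rule nn_integral_circle_rotate) (auto simp: f_def indicator_arc_periodic)
  also have "\<dots> = emeasure (von_mises 0 \<kappa>) {x \<in> {0..<2 * pi}. x \<in> circle_arc (- pi * \<tau>) (pi * \<tau>)}"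
    by (subst emeasure_von_mises) (auto simp: f_def intro!: nn_integral_cong)
  finally show ?thesis
    by (simp add: von_mises_prob_def measure_def)
qed

text \<open>For \<open>\<tau> < 1\<close> the arc \<open>[-\<pi>\<tau>, \<pi>\<tau>]\<close> does not wrap around, which turns the mass of the arc into a
quotient of two ordinary integrals.\<close>
lemma von_mises_prob_eq:
  assumes "0 < \<tau>" "\<tau> < 1"
  shows "von_mises_prob \<kappa> \<tau> = (LINT u:{- (pi * \<tau>)..pi * \<tau>}|lborel. exp (\<kappa> * cos u)) / exp_cos_total \<kappa>"
proof -
  have arc: "x \<in> circle_arc (- pi * \<tau>) (pi * \<tau>) \<longleftrightarrow> - (pi * \<tau>) \<le> x \<and> x \<le> pi * \<tau>"
    if "- pi \<le> x" "x < pi" for x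
  proof
    assume "x \<in> circle_arc (- pi * \<tau>) (pi * \<tau>)"
    then obtain k :: int where k: "- (pi * \<tau>) \<le> x + 2 * pi * of_int k" "x + 2 * pi * of_int k \<le> pi * \<tau>"
      by (auto simp: circle_arc_def)
    moreover have "pi * \<tau> < pi"
      using assms by simp
    ultimately have "2 * pi * of_int k < 2 * pi * 1" "2 * pi * (- 1) < 2 * pi * of_int k"
      using that by linarith+
    then have "real_of_int k < 1" "- 1 < real_of_int k"
      by (simp_all only: mult_less_cancel_left_pos pi_gt_zero zero_less_mult_iff zero_less_numeral simp_thms)
    then have "k = 0" by linarith
    with k show "- (pi * \<tau>) \<le> x \<and> x \<le> pi * \<tau>" by simp
  qed (auto simp: circle_arc_def intro!: exI[of _ "0::int"])
  let ?I = "LINT u:{- (pi * \<tau>)..pi * \<tau>}|lborel. exp (\<kappa> * cos u)"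
  have pos: "0 < exp_cos_total \<kappa>" by (rule exp_cos_total_pos)
  have I: "0 < ?I"
    using assms by (intro exp_cos_integral_pos) auto
  have "pi * \<tau> < pi"
    using assms by simp
  then have lt: "- pi \<le> x \<and> x < pi" if "- (pi * \<tau>) \<le> x" "x < pi * \<tau>" for x
    using that by linarith
  have "emeasure (von_mises 0 \<kappa>) {x \<in> {0..<2 * pi}. x \<in> circle_arc (- pi * \<tau>) (pi * \<tau>)}
      = (\<integral>\<^sup>+x. ennreal (1 / exp_cos_total \<kappa> * exp (\<kappa> * cos x)) * indicator (circle_arc (- pi * \<tau>) (pi * \<tau>)) x \<partial>circle_measure)"
    by (subst emeasure_von_mises) auto
  also have "\<dots> = (\<integral>\<^sup>+x. ennreal (1 / exp_cos_total \<kappa> * exp (\<kappa> * cos x)) * indicator (circle_arc (- pi * \<tau>) (pi * \<tau>)) x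
      * indicator {- pi..<- pi + 2 * pi} x \<partial>lborel)"
    by (rule nn_integral_circle_window) (auto simp: indicator_arc_periodic)
  also have "\<dots> = (\<integral>\<^sup>+x. ennreal (1 / exp_cos_total \<kappa>) * (ennreal (exp (\<kappa> * cos x)) * indicator {- (pi * \<tau>)..<pi * \<tau>} x) \<partial>lborel)"
  proof (rule nn_integral_cong_AE)
    have eq: "ennreal (1 / exp_cos_total \<kappa> * exp (\<kappa> * cos x)) = ennreal (1 / exp_cos_total \<kappa>) * ennreal (exp (\<kappa> * cos x))" for x
      using pos by (intro ennreal_mult) auto
    show "AE x in lborel. ennreal (1 / exp_cos_total \<kappa> * exp (\<kappa> * cos x)) * indicator (circle_arc (- pi * \<tau>) (pi * \<tau>)) x
        * indicator {- pi..<- pi + 2 * pi} x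
      = ennreal (1 / exp_cos_total \<kappa>) * (ennreal (exp (\<kappa> * cos x)) * indicator {- (pi * \<tau>)..<pi * \<tau>} x)"
      using AE_lborel_singleton[of "pi * \<tau>"]
    proof eventually_elim
      case (elim x)
      have "indicator (circle_arc (- pi * \<tau>) (pi * \<tau>)) x * indicator {- pi..<- pi + 2 * pi} x
        = (indicator {- (pi * \<tau>)..<pi * \<tau>} x :: ennreal)"
        using elim lt[of x] arc[of x] by (auto simp: indicator_def)
      then show ?case
        unfolding eq by (simp only: mult.assoc)
    qed
  qed
  also have "\<dots> = ennreal (1 / exp_cos_total \<kappa>) * ennreal ?I"
    unfolding exp_cos_integral by (rule nn_integral_cmult) auto
  also have "\<dots> = ennreal (?I / exp_cos_total \<kappa>)"
    using pos I by (simp add: ennreal_mult'[symmetric])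
  finally show ?thesis
    using pos I by (simp add: von_mises_prob_def measure_def)
qed

section \<open>Error probabilities of the interval test\<close>

text \<open>The exponential moment factorises over the coordinates, and each factor is
\<open>1 + (e\<^sup>s - 1) p \<le> exp ((e\<^sup>s - 1) p)\<close>. As \<open>s\<close> may have either sign, this serves both tails.\<close>
lemma exp_moment_count:
  fixes M :: "'i \<Rightarrow> 'a measure"
  assumes fin: "finite I" and prob: "\<And>i. prob_space (M i)"
    and A: "\<And>i. i \<in> I \<Longrightarrow> {x \<in> space (M i). x \<in> A i} \<in> sets (M i)"
  shows "(\<integral>\<^sup>+X. ennreal (exp (s * (\<Sum>i\<in>I. indicat_real (A i) (X i)))) \<partial>PiM I M)
    \<le> ennreal (exp ((exp s - 1) * (\<Sum>i\<in>I. measure (M i) {x \<in> space (M i). x \<in> A i})))"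
proof -
  interpret M: prob_space "M i" for i by (rule prob)
  interpret product_sigma_finite M ..
  let ?B = "\<lambda>i. {x \<in> space (M i). x \<in> A i}"
  have ind: "exp (s * indicat_real (A i) x) = 1 + (exp s - 1) * indicat_real (?B i) x"
    if "x \<in> space (M i)" for i x
    using that by (simp add: indicator_def)
  have meas: "(\<lambda>x. ennreal (exp (s * indicat_real (A i) x))) \<in> borel_measurable (M i)" if "i \<in> I" for i
    by (subst measurable_cong[OF arg_cong[where f = ennreal, OF ind]]) (use A[OF that] in measurable)
  have factor: "(\<integral>\<^sup>+x. ennreal (exp (s * indicat_real (A i) x)) \<partial>M i)
      \<le> ennreal (exp ((exp s - 1) * measure (M i) (?B i)))" if i: "i \<in> I" for i
  proof -
    have "(\<integral>\<^sup>+x. ennreal (exp (s * indicat_real (A i) x)) \<partial>M i)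
        = (\<integral>\<^sup>+x. ennreal (1 + (exp s - 1) * indicat_real (?B i) x) \<partial>M i)"
      by (intro nn_integral_cong arg_cong[where f = ennreal] ind)
    also have "\<dots> = ennreal (\<integral>x. 1 + (exp s - 1) * indicat_real (?B i) x \<partial>M i)"
    proof (rule nn_integral_eq_integral)
      show "integrable (M i) (\<lambda>x. 1 + (exp s - 1) * indicat_real (?B i) x)"
        using A[OF i] by (auto intro!: integrable_real_indicator simp: M.emeasure_eq_measure)
      show "AE x in M i. 0 \<le> 1 + (exp s - 1) * indicat_real (?B i) x"
        by (intro AE_I2) (simp add: indicator_def)
    qed
    also have "(\<integral>x. 1 + (exp s - 1) * indicat_real (?B i) x \<partial>M i) = 1 + (exp s - 1) * measure (M i) (?B i)"
      using A[OF i]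
      by (subst Bochner_Integration.integral_add)
        (auto intro!: integrable_real_indicator simp: M.emeasure_eq_measure M.prob_space Int_absorb2 subset_eq)
    also have "ennreal \<dots> \<le> ennreal (exp ((exp s - 1) * measure (M i) (?B i)))"
      by (intro ennreal_leI exp_ge_add_one_self)
    finally show ?thesis .
  qed
  have "(\<integral>\<^sup>+X. ennreal (exp (s * (\<Sum>i\<in>I. indicat_real (A i) (X i)))) \<partial>PiM I M)
      = (\<integral>\<^sup>+X. (\<Prod>i\<in>I. ennreal (exp (s * indicat_real (A i) (X i)))) \<partial>PiM I M)"
    by (simp only: sum_distrib_left exp_sum[OF fin] prod_ennreal exp_ge_zero)
  also have "\<dots> = (\<Prod>i\<in>I. \<integral>\<^sup>+x. ennreal (exp (s * indicat_real (A i) x)) \<partial>M i)"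
    using fin meas by (rule product_nn_integral_prod)
  also have "\<dots> \<le> (\<Prod>i\<in>I. ennreal (exp ((exp s - 1) * measure (M i) (?B i))))"
    using factor by (intro prod_mono_ennreal)
  also have "\<dots> = ennreal (exp ((exp s - 1) * (\<Sum>i\<in>I. measure (M i) (?B i))))"
    by (simp add: sum_distrib_left exp_sum fin prod_ennreal)
  finally show ?thesis .
qed

lemma emeasure_le_nn_integral:
  assumes "{x \<in> space M. P x} \<in> sets M" "\<And>x. x \<in> space M \<Longrightarrow> P x \<Longrightarrow> 1 \<le> f x"
  shows "emeasure M {x \<in> space M. P x} \<le> (\<integral>\<^sup>+x. f x \<partial>M)"
proof -
  have "emeasure M {x \<in> space M. P x} = (\<integral>\<^sup>+x. indicator {x \<in> space M. P x} x \<partial>M)"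
    using assms(1) by simp
  also have "\<dots> \<le> (\<integral>\<^sup>+x. f x \<partial>M)"
    using assms(2) by (intro nn_integral_mono) (auto simp: indicator_def)
  finally show ?thesis .
qed

text \<open>Integrating over \<open>X\<^sub>j = y\<close> last, the arc that starts at \<open>X\<^sub>j\<close> is fixed while the other coordinates
are integrated. The point \<open>X\<^sub>j\<close> itself always lies in its arc, which accounts for the additional
summand \<open>s\<close> in the exponent.\<close>
lemma anchored_count_tail:
  assumes j: "j \<in> {1..N}" and s: "0 \<le> s" and \<tau>: "0 \<le> \<tau>" "\<tau> < 1"
  shows "emeasure (null_law N) {X \<in> space (null_law N). \<gamma> \<le> arc_count N (2 * pi * \<tau>) X (X j)}
    \<le> ennreal (exp (s + (exp s - 1) * (real N * \<tau>) - s * \<gamma>))"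
proof -
  interpret U: prob_space uniform_angle by (rule prob_space_uniform_angle)
  interpret product_sigma_finite "\<lambda>_::nat. uniform_angle" ..
  let ?C = "\<lambda>X. arc_count N (2 * pi * \<tau>) X (X j)"
  let ?f = "\<lambda>X. ennreal (exp (s * (?C X - \<gamma>)))"
  define I where "I = {1..N} - {j}"
  have I: "finite I" "j \<notin> I" "{1..N} = insert j I"
    using j by (auto simp: I_def)
  have meas: "?C \<in> borel_measurable (null_law N)"
    unfolding null_law_def using j by (intro arc_count_measurable) auto
  then have ev: "{X \<in> space (null_law N). \<gamma> \<le> ?C X} \<in> sets (null_law N)"
    by measurable
  have f: "?f \<in> borel_measurable (PiM (insert j I) (\<lambda>_. uniform_angle))"
    using meas unfolding null_law_def I(3) by measurable
  have inner: "(\<integral>\<^sup>+X. ?f (X(j := y)) \<partial>PiM I (\<lambda>_. uniform_angle))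
      \<le> ennreal (exp (s + (exp s - 1) * (real N * \<tau>) - s * \<gamma>))" for y
  proof -
    let ?A = "circle_arc y (y + 2 * pi * \<tau>)"
    let ?S = "\<lambda>X. \<Sum>i\<in>I. indicat_real ?A (X i)"
    have le: "?C (X(j := y)) \<le> 1 + ?S X" for X
    proof -
      have "?C (X(j := y)) = indicat_real ?A y + (\<Sum>i\<in>I. indicat_real ?A ((X(j := y)) i))"
        unfolding arc_count_def I(3) using I(1,2) by (subst sum.insert) auto
      also have "(\<Sum>i\<in>I. indicat_real ?A ((X(j := y)) i)) = ?S X"
        using I(2) by (intro sum.cong) auto
      finally have eq: "?C (X(j := y)) = indicat_real ?A y + ?S X" .
      have "indicat_real ?A y \<le> 1"
        by (simp add: indicator_def)
      with eq show ?thesis by linarith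
    qed
    have "(\<integral>\<^sup>+X. ?f (X(j := y)) \<partial>PiM I (\<lambda>_. uniform_angle))
        \<le> (\<integral>\<^sup>+X. ennreal (exp (s - s * \<gamma>)) * ennreal (exp (s * ?S X)) \<partial>PiM I (\<lambda>_. uniform_angle))"
    proof (intro nn_integral_mono)
      fix X :: "nat \<Rightarrow> real"
      have "s * (?C (X(j := y)) - \<gamma>) \<le> s * ((1 + ?S X) - \<gamma>)"
        using s le[of X] by (intro mult_left_mono) auto
      then have "exp (s * (?C (X(j := y)) - \<gamma>)) \<le> exp (s - s * \<gamma>) * exp (s * ?S X)"
        by (simp add: exp_add[symmetric] algebra_simps)
      then show "?f (X(j := y)) \<le> ennreal (exp (s - s * \<gamma>)) * ennreal (exp (s * ?S X))"
        by (simp add: ennreal_mult[symmetric])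
    qed
    also have "\<dots> = ennreal (exp (s - s * \<gamma>)) * (\<integral>\<^sup>+X. ennreal (exp (s * ?S X)) \<partial>PiM I (\<lambda>_. uniform_angle))"
    proof (rule nn_integral_cmult)
      have "(\<lambda>X. ?S X) \<in> borel_measurable (PiM I (\<lambda>_. uniform_angle))"
        by (intro borel_measurable_sum indicator_circle_arc_measurable coordinate_measurable) auto
      then show "(\<lambda>X. ennreal (exp (s * ?S X))) \<in> borel_measurable (PiM I (\<lambda>_. uniform_angle))"
        by measurable
    qed
    also have "\<dots> \<le> ennreal (exp (s - s * \<gamma>)) * ennreal (exp ((exp s - 1) *
        (\<Sum>i\<in>I. measure uniform_angle {x \<in> space uniform_angle. x \<in> ?A})))"
      by (intro mult_left_mono exp_moment_count I prob_space_uniform_angle)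
        (use sets_circle_Collect[OF circle_arc_in_borel] in auto)
    also have "\<dots> = ennreal (exp (s - s * \<gamma> + (exp s - 1) * (real (card I) * \<tau>)))"
      unfolding uniform_angle_arc[OF \<tau>] by (simp add: ennreal_mult'[symmetric] exp_add)
    also have "\<dots> \<le> ennreal (exp (s + (exp s - 1) * (real N * \<tau>) - s * \<gamma>))"
    proof (intro ennreal_leI)
      have "card I \<le> N"
        using j by (simp add: I_def)
      then have "(exp s - 1) * (real (card I) * \<tau>) \<le> (exp s - 1) * (real N * \<tau>)"
        using s \<tau> by (intro mult_left_mono mult_right_mono) auto
      then show "exp (s - s * \<gamma> + (exp s - 1) * (real (card I) * \<tau>)) \<le> exp (s + (exp s - 1) * (real N * \<tau>) - s * \<gamma>)"
        by simp
    qed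
    finally show ?thesis .
  qed
  have "emeasure (null_law N) {X \<in> space (null_law N). \<gamma> \<le> ?C X} \<le> (\<integral>\<^sup>+X. ?f X \<partial>null_law N)"
    using ev s by (intro emeasure_le_nn_integral) auto
  also have "\<dots> = (\<integral>\<^sup>+y. (\<integral>\<^sup>+X. ?f (X(j := y)) \<partial>PiM I (\<lambda>_. uniform_angle)) \<partial>uniform_angle)"
    unfolding null_law_def I(3) by (rule product_nn_integral_insert_rev[OF I(1,2) f])
  also have "\<dots> \<le> (\<integral>\<^sup>+y. ennreal (exp (s + (exp s - 1) * (real N * \<tau>) - s * \<gamma>)) \<partial>uniform_angle)"
    by (intro nn_integral_mono inner)
  also have "\<dots> = ennreal (exp (s + (exp s - 1) * (real N * \<tau>) - s * \<gamma>))"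
    using U.emeasure_space_1 by simp
  finally show ?thesis .
qed

lemma false_alarm_bound:
  assumes N: "N \<ge> 1" and s: "0 \<le> s" and \<tau>: "0 \<le> \<tau>" "\<tau> < 1"
  shows "p_fa N (interval_test N \<tau> \<gamma>) \<le> real N * exp (s + (exp s - 1) * (real N * \<tau>) - s * \<gamma>)"
proof -
  let ?E = "\<lambda>j. {X \<in> space (null_law N). \<gamma> \<le> arc_count N (2 * pi * \<tau>) X (X j)}"
  let ?b = "exp (s + (exp s - 1) * (real N * \<tau>) - s * \<gamma>)"
  have meas: "?E j \<in> sets (null_law N)" if "j \<in> {1..N}" for j
  proof -
    have "(\<lambda>X. arc_count N (2 * pi * \<tau>) X (X j)) \<in> borel_measurable (null_law N)"
      unfolding null_law_def using that by (intro arc_count_measurable) auto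
    then show ?thesis by measurable
  qed
  have "{X \<in> space (null_law N). interval_test N \<tau> \<gamma> X} = (\<Union>j\<in>{1..N}. ?E j)"
    by (auto simp: interval_test_iff_data[OF N])
  then have "emeasure (null_law N) {X \<in> space (null_law N). interval_test N \<tau> \<gamma> X}
      \<le> (\<Sum>j\<in>{1..N}. emeasure (null_law N) (?E j))"
    using meas emeasure_subadditive_finite[of "{1..N}" ?E "null_law N"] by (auto simp: image_subset_iff)
  also have "\<dots> \<le> (\<Sum>j\<in>{1..N}. ennreal ?b)"
    by (intro sum_mono anchored_count_tail s \<tau>)
  also have "\<dots> = ennreal (real N * ?b)"
    by (simp add: ennreal_mult ennreal_of_nat_eq_real_of_nat)
  finally show ?thesis
    unfolding p_fa_def measure_def by (intro enn2real_leI) auto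
qed

abbreviation planted_kernel :: "nat \<Rightarrow> real \<Rightarrow> nat set \<Rightarrow> real \<Rightarrow> (nat \<Rightarrow> real) measure" where
  "planted_kernel N \<kappa> S \<Theta> \<equiv> \<Pi>\<^sub>M i\<in>{1..N}. if i \<in> S then von_mises \<Theta> \<kappa> else uniform_angle"

lemma id_circle_measurable: "(\<lambda>x. x) \<in> borel_measurable circle_measure"
  by (rule borel_measurable_circle) simp

lemma finite_measure_circle: "finite_measure circle_measure"
  by (rule finite_measureI) (simp add: emeasure_circle_space)

lemma emeasure_von_mises_measurable:
  assumes A: "A \<in> sets circle_measure"
  shows "(\<lambda>\<Theta>. emeasure (von_mises \<Theta> \<kappa>) A) \<in> borel_measurable borel"
proof -
  interpret C: finite_measure circle_measure by (rule finite_measure_circle)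
  have [measurable]: "(\<lambda>p. snd p) \<in> borel_measurable (borel \<Otimes>\<^sub>M circle_measure)"
    by (rule measurable_compose[OF measurable_snd id_circle_measurable])
  have "emeasure (von_mises \<Theta> \<kappa>) A = (\<integral>\<^sup>+x. ennreal (1 / exp_cos_total \<kappa> * exp (\<kappa> * cos (x - \<Theta>))) * indicator A x \<partial>circle_measure)"
    for \<Theta>
    unfolding von_mises_def bessel_I0_eq using A
    by (intro emeasure_density) (auto intro!: borel_measurable_circle)
  moreover have "(\<lambda>\<Theta>. \<integral>\<^sup>+x. ennreal (1 / exp_cos_total \<kappa> * exp (\<kappa> * cos (x - \<Theta>))) * indicator A x \<partial>circle_measure) \<in> borel_measurable borel"
  proof (rule C.borel_measurable_nn_integral)
    have "indicator A \<in> borel_measurable circle_measure"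
      using A by simp
    then have "(\<lambda>p. indicator A (snd p) :: ennreal) \<in> borel_measurable (borel \<Otimes>\<^sub>M circle_measure)"
      by (rule measurable_compose[OF measurable_snd])
    then show "(\<lambda>(\<Theta>, x). ennreal (1 / exp_cos_total \<kappa> * exp (\<kappa> * cos (x - \<Theta>))) * indicator A x)
        \<in> borel_measurable (borel \<Otimes>\<^sub>M circle_measure)"
      unfolding split_beta' by measurable
  qed
  ultimately show ?thesis by simp
qed

text \<open>The planted law is an iterated bind, and integrals against it can be evaluated only once the inner
law is known to depend measurably on the phase. It suffices to check this on rectangles,
where the product measure is a finite product of masses.\<close>
lemma planted_kernel_measurable:
  "planted_kernel N \<kappa> S \<in> uniform_angle \<rightarrow>\<^sub>M prob_algebra (PiM {1..N} (\<lambda>_. circle_measure))"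
proof (rule measurable_prob_algebra_generated[OF sets_PiM Int_stable_prod_algebra prod_algebra_sets_into_space])
  let ?M = "\<lambda>\<Theta> i. if i \<in> S then von_mises \<Theta> \<kappa> else uniform_angle"
  have prob: "prob_space (?M \<Theta> i)" for \<Theta> i
    by (simp add: prob_space_von_mises prob_space_uniform_angle)
  show "prob_space (planted_kernel N \<kappa> S \<Theta>)" for \<Theta>
    by (intro prob_space_PiM prob)
  show "sets (planted_kernel N \<kappa> S \<Theta>) = sets (PiM {1..N} (\<lambda>_. circle_measure))" for \<Theta>
    by (intro sets_PiM_cong) auto
  fix A assume "A \<in> prod_algebra {1..N} (\<lambda>_. circle_measure)"
  then obtain E where E: "A = Pi\<^sub>E {1..N} E" "\<And>i. i \<in> {1..N} \<Longrightarrow> E i \<in> sets circle_measure"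
    by (elim prod_algebraE_all) (simp add: Pi_iff)
  have "emeasure (planted_kernel N \<kappa> S \<Theta>) A = (\<Prod>i\<in>{1..N}. emeasure (?M \<Theta> i) (E i))" for \<Theta>
  proof -
    interpret M: prob_space "?M \<Theta> i" for i by (rule prob)
    interpret product_sigma_finite "?M \<Theta>" ..
    show ?thesis
      unfolding E(1) using E(2) by (intro emeasure_PiM) auto
  qed
  moreover have "(\<lambda>\<Theta>. emeasure (?M \<Theta> i) (E i)) \<in> borel_measurable uniform_angle" if "i \<in> {1..N}" for i
  proof -
    have "(\<lambda>\<Theta>. emeasure (?M \<Theta> i) (E i)) \<in> borel_measurable borel"
      using emeasure_von_mises_measurable[OF E(2)[OF that], of \<kappa>] by (cases "i \<in> S") simp_all
    from borel_measurable_circle[OF this] show ?thesis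
      by (simp cong: measurable_cong_sets)
  qed
  ultimately show "(\<lambda>\<Theta>. emeasure (planted_kernel N \<kappa> S \<Theta>) A) \<in> borel_measurable uniform_angle"
    by (simp add: borel_measurable_prod)
qed

text \<open>If the test accepts, then in particular the arc centred at the phase contains at most \<open>\<gamma>\<close>
points. The mean number of points in it is \<open>(N - K) \<tau> + K p\<^sub>\<kappa>(\<tau>)\<close>, whatever the subset and the phase
are, so the Chernoff bound is uniform over both.\<close>
lemma planted_kernel_miss:
  assumes S: "S \<subseteq> {1..N}" "card S = K" and s: "0 \<le> s" and \<tau>: "0 \<le> \<tau>" "\<tau> < 1"
  shows "emeasure (planted_kernel N \<kappa> S \<Theta>) {X \<in> space (planted_kernel N \<kappa> S \<Theta>). \<not> interval_test N \<tau> \<gamma> X}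
    \<le> ennreal (exp ((exp (- s) - 1) * (real N * \<tau> + window_gain K \<kappa> \<tau>) + s * \<gamma>))"
proof -
  let ?M = "\<lambda>i. if i \<in> S then von_mises \<Theta> \<kappa> else uniform_angle"
  let ?a = "\<Theta> - pi * \<tau>"
  let ?A = "circle_arc ?a (?a + 2 * pi * \<tau>)"
  let ?C = "\<lambda>X. arc_count N (2 * pi * \<tau>) X ?a"
  have sets: "sets (?M i) = sets circle_measure" and space: "space (?M i) = {0..<2 * pi}" for i
    by auto
  have prob: "prob_space (?M i)" for i
    by (simp add: prob_space_von_mises prob_space_uniform_angle)
  have mean: "(\<Sum>i\<in>{1..N}. measure (?M i) {x \<in> space (?M i). x \<in> ?A}) = real N * \<tau> + window_gain K \<kappa> \<tau>"
  proof -
    have "(\<Sum>i\<in>{1..N}. measure (?M i) {x \<in> space (?M i). x \<in> ?A})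
        = (\<Sum>i\<in>{1..N}. \<tau> + (if i \<in> S then von_mises_prob \<kappa> \<tau> - \<tau> else 0))"
      using von_mises_arc[of \<Theta> \<kappa> \<tau>] uniform_angle_arc[OF \<tau>, of ?a] by (intro sum.cong) auto
    also have "\<dots> = real N * \<tau> + real (card S) * (von_mises_prob \<kappa> \<tau> - \<tau>)"
      using S(1) by (simp add: sum.distrib sum.inter_restrict[symmetric] Int_absorb1)
    finally show ?thesis
      using S(2) by (simp add: window_gain_def)
  qed
  have "{X \<in> space (PiM {1..N} ?M). \<not> interval_test N \<tau> \<gamma> X} \<in> sets (PiM {1..N} ?M)"
    using interval_test_measurable[of ?M N \<tau> \<gamma>, OF sets] by measurable
  then have "emeasure (PiM {1..N} ?M) {X \<in> space (PiM {1..N} ?M). \<not> interval_test N \<tau> \<gamma> X}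
      \<le> (\<integral>\<^sup>+X. ennreal (exp (s * (\<gamma> - ?C X))) \<partial>PiM {1..N} ?M)"
  proof (rule emeasure_le_nn_integral)
    fix X assume "\<not> interval_test N \<tau> \<gamma> X"
    then have "?C X \<le> \<gamma>"
      using arc_count_le_SUP[of N "2 * pi * \<tau>" X ?a]
      by (simp add: interval_test_def arc_count_def)
    then show "1 \<le> ennreal (exp (s * (\<gamma> - ?C X)))"
      using s by simp
  qed
  also have "\<dots> = (\<integral>\<^sup>+X. ennreal (exp (s * \<gamma>)) * ennreal (exp (- s * ?C X)) \<partial>PiM {1..N} ?M)"
    by (intro nn_integral_cong) (simp add: ennreal_mult[symmetric] exp_add[symmetric] algebra_simps)
  also have "\<dots> = ennreal (exp (s * \<gamma>)) * (\<integral>\<^sup>+X. ennreal (exp (- s * ?C X)) \<partial>PiM {1..N} ?M)"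
    using arc_count_measurable(1)[of ?M N "2 * pi * \<tau>" ?a, OF sets]
    by (intro nn_integral_cmult) measurable
  also have "(\<integral>\<^sup>+X. ennreal (exp (- s * ?C X)) \<partial>PiM {1..N} ?M)
      \<le> ennreal (exp ((exp (- s) - 1) * (\<Sum>i\<in>{1..N}. measure (?M i) {x \<in> space (?M i). x \<in> ?A})))"
    unfolding arc_count_def
    by (intro exp_moment_count prob finite_atLeastAtMost)
      (use sets_circle_Collect[OF circle_arc_in_borel] in \<open>simp add: sets space\<close>)
  finally show ?thesis
    unfolding mean by (simp add: mult_left_mono ennreal_mult[symmetric] exp_add[symmetric] add.commute)
qed

lemma miss_bound:
  assumes K: "K \<le> N" and s: "0 \<le> s" and \<tau>: "0 \<le> \<tau>" "\<tau> < 1"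
  shows "p_miss N K \<kappa> (interval_test N \<tau> \<gamma>)
    \<le> exp ((exp (- s) - 1) * (real N * \<tau> + window_gain K \<kappa> \<tau>) + s * \<gamma>)"
proof -
  let ?R = "PiM {1..N} (\<lambda>_. circle_measure)"
  let ?SS = "{S. S \<subseteq> {1..N} \<and> card S = K}"
  let ?b = "exp ((exp (- s) - 1) * (real N * \<tau> + window_gain K \<kappa> \<tau>) + s * \<gamma>)"
  let ?E = "{X \<in> space ?R. \<not> interval_test N \<tau> \<gamma> X}"
  interpret U: prob_space uniform_angle by (rule prob_space_uniform_angle)
  have E: "?E \<in> sets ?R"
    using interval_test_measurable[of "\<lambda>_. circle_measure" N \<tau> \<gamma>] by measurable
  have kernel: "planted_kernel N \<kappa> S \<in> uniform_angle \<rightarrow>\<^sub>M subprob_algebra ?R" for S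
    by (rule measurable_prob_algebraD[OF planted_kernel_measurable])
  have sets_kernel: "sets (planted_kernel N \<kappa> S \<Theta>) = sets ?R" for S \<Theta>
    by (intro sets_PiM_cong) auto
  have ne: "space uniform_angle \<noteq> {}"
    by (rule U.not_empty)
  have sets_inner: "sets (uniform_angle \<bind> planted_kernel N \<kappa> S) = sets ?R" for S
    by (rule sets_bind[OF sets_kernel ne])
  have outer: "(\<lambda>S. uniform_angle \<bind> planted_kernel N \<kappa> S) \<in> measure_pmf p \<rightarrow>\<^sub>M subprob_algebra ?R" for p
    using subprob_space_bind[OF prob_space_imp_subprob_space[OF prob_space_uniform_angle] kernel]
      sets_inner
    by (auto simp: space_subprob_algebra simp del: sets_bind)
  have fin: "finite ?SS" "?SS \<noteq> {}"
    using K ex_card[of K "{1..N}"] by (auto intro: finite_subset[of _ "Pow {1..N}"])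
  have law: "planted_law N K \<kappa> = measure_pmf (pmf_of_set ?SS) \<bind> (\<lambda>S. uniform_angle \<bind> planted_kernel N \<kappa> S)"
    by (simp add: planted_law_def)
  have sets_law: "sets (planted_law N K \<kappa>) = sets ?R"
    unfolding law
    by (rule sets_bind[OF sets_inner]) simp
  have "emeasure (planted_law N K \<kappa>) ?E
      = (\<integral>\<^sup>+S. emeasure (uniform_angle \<bind> planted_kernel N \<kappa> S) ?E \<partial>measure_pmf (pmf_of_set ?SS))"
    unfolding law by (rule emeasure_bind[OF _ outer E]) simp
  also have "\<dots> \<le> (\<integral>\<^sup>+S. ennreal ?b \<partial>measure_pmf (pmf_of_set ?SS))"
  proof (rule nn_integral_mono_AE)
    have "emeasure (uniform_angle \<bind> planted_kernel N \<kappa> S) ?E \<le> ennreal ?b" if "S \<in> ?SS" for S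
    proof -
      have "emeasure (uniform_angle \<bind> planted_kernel N \<kappa> S) ?E
          = (\<integral>\<^sup>+\<Theta>. emeasure (planted_kernel N \<kappa> S \<Theta>) ?E \<partial>uniform_angle)"
        by (rule emeasure_bind[OF ne kernel E])
      also have "\<dots> \<le> (\<integral>\<^sup>+\<Theta>. ennreal ?b \<partial>uniform_angle)"
        using planted_kernel_miss[where S = S and N = N and \<kappa> = \<kappa> and \<gamma> = \<gamma>] that s \<tau> sets_eq_imp_space_eq[OF sets_kernel[of S]]
        by (intro nn_integral_mono) auto
      finally show ?thesis
        using U.emeasure_space_1 by simp
    qed
    then show "AE S in measure_pmf (pmf_of_set ?SS). emeasure (uniform_angle \<bind> planted_kernel N \<kappa> S) ?E \<le> ennreal ?b"
      by (intro AE_pmfI) (use fin in auto)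
  qed
  also have "\<dots> = ennreal ?b"
    by (simp add: measure_pmf.emeasure_space_1[simplified])
  finally show ?thesis
    unfolding p_miss_def measure_def sets_eq_imp_space_eq[OF sets_law] by (intro enn2real_leI) auto
qed

section \<open>The Gaussian window cost\<close>

lemma integrable_std_normal_indicator:
  "A \<in> sets borel \<Longrightarrow> integrable lborel (\<lambda>x. indicat_real A x * std_normal_density x)"
  using integrable_mult_indicator[of A lborel std_normal_density] by simp

lemma gaussian_Q_eq: "gaussian_Q c = (LINT x|lborel. indicat_real {c<..} x * std_normal_density x)"
proof -
  have "gaussian_Q c = (LINT x|std_normal_distribution. indicat_real {c<..} x)"
    by (simp add: gaussian_Q_def)
  also have "\<dots> = (LINT x|lborel. std_normal_density x *\<^sub>R indicat_real {c<..} x)"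
    by (intro integral_density) auto
  finally show ?thesis
    by (simp add: mult.commute)
qed

definition gaussian_window :: "real \<Rightarrow> real" where
  "gaussian_window c = 1 - 2 * gaussian_Q c"

text \<open>The two tails have equal mass because the density is even.\<close>
lemma gaussian_window_eq:
  assumes "0 \<le> c"
  shows "gaussian_window c = (LINT x|lborel. indicat_real {- c..c} x * std_normal_density x)"
proof -
  let ?I = "\<lambda>A. LINT x|lborel. indicat_real A x * std_normal_density x"
  have "?I {..<- c} = (LINT x|lborel. indicat_real {..<- c} (0 + (- 1) * x) * std_normal_density (0 + (- 1) * x))"
    by (subst lborel_integral_real_affine[where c = "- 1" and t = 0]) auto
  also have "\<dots> = ?I {c<..}"
    by (intro Bochner_Integration.integral_cong) (auto simp: indicator_def std_normal_density_def)
  finally have refl: "?I {..<- c} = ?I {c<..}" .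
  have "1 = (LINT x|lborel. std_normal_density x)"
    by simp
  also have "\<dots> = (LINT x|lborel. (indicat_real {..<- c} x * std_normal_density x
      + indicat_real {- c..c} x * std_normal_density x) + indicat_real {c<..} x * std_normal_density x)"
    using assms by (intro Bochner_Integration.integral_cong) (auto simp: indicator_def)
  also have "\<dots> = (?I {..<- c} + ?I {- c..c}) + ?I {c<..}"
    by (simp add: integrable_std_normal_indicator)
  finally show ?thesis
    using refl by (simp add: gaussian_window_def gaussian_Q_eq)
qed

lemma integrable_indicator_const: "integrable lborel (\<lambda>x. indicat_real {a..b :: real} x * d)"
  by (intro integrable_mult_left integrable_real_indicator) (auto simp: emeasure_lborel_Icc_eq)

lemma gaussian_window_le: "0 \<le> c \<Longrightarrow> gaussian_window c \<le> c"
proof -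
  assume c: "0 \<le> c"
  have "2 \<le> sqrt (2 * pi)"
    using pi_ge_two by (intro real_le_rsqrt) (simp add: power2_eq_square)
  then have "1 / sqrt (2 * pi) \<le> 1 / 2"
    by (intro divide_left_mono) auto
  moreover have "exp (- x\<^sup>2 / 2) \<le> 1" for x :: real
    by simp
  ultimately have D: "std_normal_density x \<le> 1 / 2" for x
    unfolding std_normal_density_def
    using mult_mono[of "1 / sqrt (2 * pi)" "1 / 2" "exp (- x\<^sup>2 / 2)" 1] by simp
  have "gaussian_window c \<le> (LINT x|lborel. indicat_real {- c..c} x * (1 / 2))"
    unfolding gaussian_window_eq[OF c]
    by (intro integral_mono integrable_std_normal_indicator integrable_indicator_const mult_left_mono D) auto
  also have "\<dots> = c"
    using c by simp
  finally show ?thesis .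
qed

lemma gaussian_window_pos:
  assumes c: "0 < c"
  shows "0 < gaussian_window c"
proof -
  have "0 < (2 * c) * (1 / sqrt (2 * pi) * exp (- c\<^sup>2 / 2))"
    using c by simp
  also have "\<dots> = (LINT x|lborel. indicat_real {- c..c} x * (1 / sqrt (2 * pi) * exp (- c\<^sup>2 / 2)))"
    using c by simp
  also have "\<dots> \<le> gaussian_window c"
  proof -
    have "x\<^sup>2 \<le> c\<^sup>2" if "- c \<le> x" "x \<le> c" for x
      using that by (simp add: abs_le_square_iff[symmetric] abs_le_iff)
    then show ?thesis
      unfolding gaussian_window_eq[OF less_imp_le[OF c]]
      by (intro integral_mono integrable_std_normal_indicator integrable_indicator_const)
        (auto simp: indicator_def std_normal_density_def divide_right_mono)
  qed
  finally show ?thesis .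
qed

lemma gaussian_window_le_1: "gaussian_window c \<le> 1"
  by (simp add: gaussian_window_def gaussian_Q_def)

lemma isCont_gaussian_window: "isCont gaussian_window c"
proof -
  interpret N: real_distribution std_normal_distribution by (rule real_dist_normal_dist)
  have Q: "gaussian_Q x = 1 - cdf std_normal_distribution x" for x
  proof -
    have "{x<..} = UNIV - {..x}"
      by auto
    then show ?thesis
      using N.prob_compl[of "{..x}"] by (simp add: gaussian_Q_def cdf_def)
  qed
  have "AE y in lborel. ennreal (std_normal_density y) * indicator {c} y = 0"
    using AE_lborel_singleton[of c] by eventually_elim auto
  then have "emeasure std_normal_distribution {c} = 0"
    by (subst emeasure_density) (auto simp: nn_integral_0_iff_AE)
  then have "isCont (cdf std_normal_distribution) c"
    by (simp add: N.isCont_cdf measure_def)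
  then show ?thesis
    unfolding gaussian_window_def[abs_def] Q by (intro continuous_intros)
qed

lemma window_cost_eq: "window_cost c = c / (gaussian_window c)\<^sup>2"
  by (simp add: window_cost_def gaussian_window_def)

text \<open>These two bounds make the cost blow up at both ends of \<open>(0, \<infinity>)\<close>: the window mass is at most \<open>1\<close>,
and also at most \<open>c\<close> because the Gaussian density is below \<open>1/2\<close>.\<close>
lemma window_cost_ge:
  assumes c: "0 < c"
  shows "c \<le> window_cost c" "1 / c \<le> window_cost c"
proof -
  have sq: "0 < (gaussian_window c)\<^sup>2"
    using gaussian_window_pos[OF c] by simp
  have "(gaussian_window c)\<^sup>2 \<le> 1"
    using gaussian_window_pos[OF c] gaussian_window_le_1[of c] by (simp add: power_le_one)
  then show "c \<le> window_cost c"
    using sq c by (simp add: window_cost_eq le_divide_eq mult_left_le)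
  have "(gaussian_window c)\<^sup>2 \<le> c\<^sup>2"
    using gaussian_window_pos[OF c] gaussian_window_le[of c] c by (intro power_mono) auto
  then show "1 / c \<le> window_cost c"
    using sq c by (simp add: window_cost_eq divide_simps power2_eq_square)
qed

text \<open>Outside the compact interval \<open>[1/m, m]\<close> the cost is at least \<open>m\<close>, which is no smaller than the
cost at \<open>1\<close>. A minimiser over that interval is therefore global.\<close>
lemma window_cost_minimizer: "\<exists>c2. is_arg_min window_cost (\<lambda>c. c > 0) c2"
proof -
  \<comment> \<open>at least \<open>1\<close>, so that \<open>[1/m, m]\<close> contains the reference point \<open>1\<close>\<close>
  define m where "m = max 1 (window_cost 1)"
  have m: "1 \<le> m" "window_cost 1 \<le> m"
    by (auto simp: m_def)
  have "continuous_on {1 / m..m} window_cost"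
  proof (rule continuous_at_imp_continuous_on, safe)
    fix x assume "x \<in> {1 / m..m}"
    moreover have "0 < 1 / m"
      using m by simp
    ultimately have "0 < x"
      by (meson atLeastAtMost_iff less_le_trans)
    then show "isCont window_cost x"
      unfolding window_cost_eq[abs_def]
      using gaussian_window_pos[of x] isCont_gaussian_window[of x] by (intro continuous_intros) auto
  qed
  moreover have one: "1 \<in> {1 / m..m}"
    using m by simp
  ultimately obtain c2 where c2: "c2 \<in> {1 / m..m}" "\<And>c. c \<in> {1 / m..m} \<Longrightarrow> window_cost c2 \<le> window_cost c"
    using continuous_attains_inf[of "{1 / m..m}" window_cost] by auto
  have "0 < 1 / m"
    using m by simp
  with c2(1) have "0 < c2"
    by (meson atLeastAtMost_iff less_le_trans)
  moreover have "window_cost c2 \<le> window_cost c" if "0 < c" for c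
  proof (cases "c \<in> {1 / m..m}")
    case False
    have "window_cost c2 \<le> m"
      using c2(2)[OF one] m by simp
    also have "m \<le> window_cost c"
    proof (cases "m < c")
      case True
      then show ?thesis
        using window_cost_ge(1)[OF that] by simp
    next
      case less: False
      with False have "c < 1 / m"
        by auto
      then have "m \<le> 1 / c"
        using that m by (simp add: field_simps)
      then show ?thesis
        using window_cost_ge(2)[OF that] by simp
    qed
    finally show ?thesis .
  qed (use c2 in auto)
  ultimately show ?thesis
    unfolding is_arg_min_def by (metis not_less)
qed

lemma critical_const_eq:
  assumes "is_arg_min window_cost (\<lambda>c. c > 0) c2"
  shows "critical_const = 2 / pi * (c2 / (gaussian_window c2)\<^sup>2)"
proof -
  have "(INF c\<in>{0<..}. window_cost c) = window_cost c2"
    using assms unfolding is_arg_min_def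
    by (intro cInf_eq_minimum) (auto simp: not_less simp flip: not_le)
  then show ?thesis
    by (simp add: critical_const_def window_cost_eq)
qed

section \<open>Mass of the von Mises law in a symmetric window\<close>
text \<open>This provides the integrable majorant in Laplace's method. The
constant \<open>1/18\<close> is not sharp; it comes from \<open>sin v \<ge> v / 3\<close> on \<open>[0, 2]\<close> with \<open>v = \<bar>u\<bar> / 2\<close>.\<close>
lemma cos_le_quadratic:
  fixes u :: real
  assumes "\<bar>u\<bar> \<le> pi"
  shows "cos u \<le> 1 - u\<^sup>2 / 18"
proof -
  define v where "v = \<bar>u\<bar> / 2"
  have v: "0 \<le> v" "v \<le> 2"
    using assms pi_less_4 by (auto simp: v_def)
  have "\<bar>sin v - v\<bar> \<le> v ^ 3 / 6"
    using Maclaurin_sin_bound[of v 3] v(1)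
    by (simp add: numeral_3_eq_3 sin_coeff_def fact_numeral inverse_eq_divide)
  moreover have "v ^ 3 \<le> 4 * v"
  proof -
    have "v\<^sup>2 \<le> 2\<^sup>2"
      using v by (intro power_mono) auto
    then have "v * v\<^sup>2 \<le> v * 4"
      using v by (intro mult_left_mono) auto
    then show ?thesis
      by (simp add: power3_eq_cube power2_eq_square)
  qed
  ultimately have "v / 3 \<le> sin v"
    by linarith
  then have "(v / 3)\<^sup>2 \<le> (sin v)\<^sup>2"
    using v by (intro power_mono) auto
  moreover have "cos u = 1 - 2 * (sin v)\<^sup>2"
  proof -
    have "cos u = cos (2 * v)"
      by (simp add: v_def)
    also have "\<dots> = 1 - 2 * (sin v)\<^sup>2"
      by (rule cos_double_sin)
    finally show ?thesis .
  qed
  ultimately show ?thesis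
    by (simp add: v_def power_divide)
qed

text \<open>The substitution \<open>u = x / \<surd>k\<close> zooms in on the mode at its natural width, with the maximum
\<open>e\<^sup>k\<close> of the integrand pulled out.\<close>
lemma exp_cos_scaled:
  fixes r k :: real
  assumes k: "0 < k"
  shows "(LINT u:{- r..r}|lborel. exp (k * cos u)) =
    exp k / sqrt k * (LINT x|lborel. indicat_real {- (r * sqrt k)..r * sqrt k} x * exp (k * (cos (x / sqrt k) - 1)))"
proof -
  have s: "0 < sqrt k"
    using k by simp
  have iff: "- r \<le> x / sqrt k \<and> x / sqrt k \<le> r \<longleftrightarrow> - (r * sqrt k) \<le> x \<and> x \<le> r * sqrt k" for x
    using s by (simp add: field_simps)
  have "(LINT u:{- r..r}|lborel. exp (k * cos u)) = (LINT u|lborel. indicat_real {- r..r} u * exp (k * cos u))"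
    by (simp add: set_lebesgue_integral_def)
  also have "\<dots> = 1 / sqrt k * (LINT x|lborel. indicat_real {- r..r} (0 + 1 / sqrt k * x) * exp (k * cos (0 + 1 / sqrt k * x)))"
    using s by (subst lborel_integral_real_affine[where c = "1 / sqrt k" and t = 0]) auto
  also have "(LINT x|lborel. indicat_real {- r..r} (0 + 1 / sqrt k * x) * exp (k * cos (0 + 1 / sqrt k * x)))
      = (LINT x|lborel. exp k * (indicat_real {- (r * sqrt k)..r * sqrt k} x * exp (k * (cos (x / sqrt k) - 1))))"
    using iff by (intro Bochner_Integration.integral_cong)
      (auto simp: indicator_def exp_add[symmetric] algebra_simps)
  finally show ?thesis
    by simp
qed

text \<open>Dominated convergence: \<open>k (cos (x/\<surd>k) - 1)\<close> tends to \<open>- x\<^sup>2/2\<close>, and it is at most \<open>- x\<^sup>2/18\<close>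
as long as \<open>\<bar>x\<bar> \<le> \<pi>\<surd>k\<close>. The range \<open>r\<close> may vary with \<open>k\<close> so that both a fixed window and
the whole circle are covered.\<close>
lemma laplace_limit:
  fixes r :: "real \<Rightarrow> real" and B :: "real set"
  assumes r: "\<forall>\<^sub>F k in at_top. r k \<le> pi * sqrt k"
    and ind: "\<And>x. ((\<lambda>k. indicat_real {- r k..r k} x) \<longlongrightarrow> indicat_real B x) at_top"
    and [measurable]: "B \<in> sets borel"
  shows "((\<lambda>k. LINT x|lborel. indicat_real {- r k..r k} x * exp (k * (cos (x / sqrt k) - 1)))
    \<longlongrightarrow> (LINT x|lborel. indicat_real B x * exp (- x\<^sup>2 / 2))) at_top"
proof (rule integral_dominated_convergence_at_top)
  define w :: "real \<Rightarrow> real" where "w x = exp (- x\<^sup>2 / 18)" for x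
  show "integrable lborel w"
  proof -
    have "integrable lborel (\<lambda>x. sqrt (2 * pi * 3\<^sup>2) * normal_density 0 3 x)"
      by (intro integrable_mult_right integrable_normal_density) auto
    then show ?thesis
      by (simp add: w_def[abs_def] normal_density_def)
  qed
  show "\<forall>\<^sub>F k in at_top. AE x in lborel.
      norm (indicat_real {- r k..r k} x * exp (k * (cos (x / sqrt k) - 1))) \<le> w x"
    using r eventually_gt_at_top[of 0]
  proof eventually_elim
    case (elim k)
    have "norm (indicat_real {- r k..r k} x * exp (k * (cos (x / sqrt k) - 1))) \<le> w x" for x
    proof (cases "x \<in> {- r k..r k}")
      case True
      then have "\<bar>x\<bar> \<le> pi * sqrt k"
        using elim(1) by auto
      then have "\<bar>x / sqrt k\<bar> \<le> pi"
        using elim(2) by (simp add: field_simps)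
      then have "cos (x / sqrt k) \<le> 1 - (x / sqrt k)\<^sup>2 / 18"
        by (rule cos_le_quadratic)
      then have "k * (cos (x / sqrt k) - 1) \<le> k * (- (x / sqrt k)\<^sup>2 / 18)"
        using elim(2) by (intro mult_left_mono) auto
      also have "\<dots> = - x\<^sup>2 / 18"
        using elim(2) by (simp add: power_divide)
      finally show ?thesis
        using True by (simp add: w_def)
    qed (simp add: w_def)
    then show ?case by simp
  qed
  show "AE x in lborel. ((\<lambda>k. indicat_real {- r k..r k} x * exp (k * (cos (x / sqrt k) - 1)))
      \<longlongrightarrow> indicat_real B x * exp (- x\<^sup>2 / 2)) at_top"
  proof (intro AE_I2 tendsto_mult ind tendsto_exp)
    fix x :: real
    show "((\<lambda>k. k * (cos (x / sqrt k) - 1)) \<longlongrightarrow> - x\<^sup>2 / 2) at_top"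
    proof (cases "x = 0")
      case False
      then have "((\<lambda>k. k * (cos (x / sqrt k) - 1)) \<longlongrightarrow> - (x * x / 2)) at_top"
        by real_asymp
      then show ?thesis
        by (simp add: power2_eq_square)
    qed simp
  qed
qed auto

text \<open>The scaled window has constant half-width \<open>b\<close>, while the scaled circle fills the real line. In
the quotient the common factor \<open>e\<^sup>k/\<surd>k\<close> cancels.\<close>
lemma von_mises_prob_limit:
  assumes b: "0 < b"
  shows "((\<lambda>k. von_mises_prob k (b / (pi * sqrt k))) \<longlongrightarrow> gaussian_window b) at_top"
proof -
  let ?F = "\<lambda>r k. LINT x|lborel. indicat_real {- r..r} x * exp (k * (cos (x / sqrt k) - 1))"
  have D: "exp (- x\<^sup>2 / 2) = sqrt (2 * pi) * std_normal_density x" for x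
    by (simp add: std_normal_density_def)
  have up: "\<forall>\<^sub>F k in at_top. y \<le> pi * sqrt k" for y
  proof -
    have "filterlim (\<lambda>k. pi * sqrt k) at_top at_top"
      by real_asymp
    then show ?thesis
      by (simp add: filterlim_at_top)
  qed
  have "((\<lambda>k. ?F b k) \<longlongrightarrow> (LINT x|lborel. indicat_real {- b..b} x * exp (- x\<^sup>2 / 2))) at_top"
    by (rule laplace_limit) (use up in auto)
  also have "(LINT x|lborel. indicat_real {- b..b} x * exp (- x\<^sup>2 / 2))
      = (LINT x|lborel. sqrt (2 * pi) * (indicat_real {- b..b} x * std_normal_density x))"
    unfolding D by (simp only: mult.left_commute)
  also have "\<dots> = sqrt (2 * pi) * gaussian_window b"
    using b by (simp add: gaussian_window_eq)
  finally have num: "((\<lambda>k. ?F b k) \<longlongrightarrow> sqrt (2 * pi) * gaussian_window b) at_top" .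
  have "((\<lambda>k. ?F (pi * sqrt k) k) \<longlongrightarrow> (LINT x|lborel. indicat_real UNIV x * exp (- x\<^sup>2 / 2))) at_top"
  proof (rule laplace_limit)
    fix x
    have "\<forall>\<^sub>F k in at_top. indicat_real {- (pi * sqrt k)..pi * sqrt k} x = indicat_real UNIV x"
      using up[of "\<bar>x\<bar>"] by eventually_elim (auto simp: indicator_def)
    then show "((\<lambda>k. indicat_real {- (pi * sqrt k)..pi * sqrt k} x) \<longlongrightarrow> indicat_real UNIV x) at_top"
      by (rule tendsto_eventually)
  qed auto
  also have "(LINT x|lborel. indicat_real UNIV x * exp (- x\<^sup>2 / 2)) = sqrt (2 * pi)"
    unfolding D by simp
  finally have den: "((\<lambda>k. ?F (pi * sqrt k) k) \<longlongrightarrow> sqrt (2 * pi)) at_top" .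
  have "((\<lambda>k. ?F b k / ?F (pi * sqrt k) k) \<longlongrightarrow> sqrt (2 * pi) * gaussian_window b / sqrt (2 * pi)) at_top"
    by (intro tendsto_divide num den) simp
  moreover have "\<forall>\<^sub>F k in at_top. ?F b k / ?F (pi * sqrt k) k = von_mises_prob k (b / (pi * sqrt k))"
    using eventually_gt_at_top[of 0] up[of "b + 1"]
  proof eventually_elim
    case (elim k)
    then have \<tau>: "0 < b / (pi * sqrt k)" "b / (pi * sqrt k) < 1"
      using b by auto
    have r: "pi * (b / (pi * sqrt k)) = b / sqrt k" "b / sqrt k * sqrt k = b"
      using elim by auto
    show ?case
      unfolding von_mises_prob_eq[OF \<tau>] r(1) exp_cos_scaled[OF elim(1)] r(2)
      using elim(1) by simp
  qed
  ultimately show ?thesis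
    by (auto intro: Lim_transform_eventually)
qed

lemma sin_minus_x_cos_mono:
  fixes x y :: real
  assumes "0 \<le> x" "x \<le> y" "y \<le> pi"
  shows "sin x - x * cos x \<le> sin y - y * cos y"
proof (rule DERIV_nonneg_imp_nondecreasing[OF assms(2)])
  fix u assume u: "x \<le> u" "u \<le> y"
  have "((\<lambda>u. sin u - u * cos u) has_real_derivative u * sin u) (at u)"
    by (auto intro!: derivative_eq_intros)
  moreover have "0 \<le> u * sin u"
    using u assms by (intro mult_nonneg_nonneg sin_ge_zero) auto
  ultimately show "\<exists>d. ((\<lambda>u. sin u - u * cos u) has_real_derivative d) (at u) \<and> 0 \<le> d"
    by blast
qed

lemma sin_minus_x_cos_pos:
  fixes x :: real
  assumes "0 < x" "x < pi"
  shows "0 < sin x - x * cos x"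
proof -
  have "sin 0 - 0 * cos 0 < sin x - x * cos x"
  proof (rule DERIV_pos_imp_increasing_open[OF assms(1)])
    fix u assume u: "0 < u" "u < x"
    have "((\<lambda>u. sin u - u * cos u) has_real_derivative u * sin u) (at u)"
      by (auto intro!: derivative_eq_intros)
    moreover have "0 < u * sin u"
      using u assms by (intro mult_pos_pos sin_gt_zero) auto
    ultimately show "\<exists>d. ((\<lambda>u. sin u - u * cos u) has_real_derivative d) (at u) \<and> 0 < d"
      by blast
  qed (intro continuous_intros)
  then show ?thesis by simp
qed

text \<open>Rescale the density to have value \<open>1\<close> at the ends \<open>\<plusminus>t\<close> of the window, where \<open>t = \<pi>\<tau>\<close>. As the density decreases
away from the mode, its integral outside the window is then at most \<open>2\<pi> - 2t\<close>. Inside, it is at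
least \<open>1 + \<kappa>0 (cos u - cos t)\<close>, whose integral exceeds the length \<open>2t\<close> of the window by
\<open>2 \<kappa>0 (sin t - t cos t) \<ge> h\<close>, because \<open>sin t - t cos t\<close> increases on \<open>[0, \<pi>]\<close>. So the window holds
at least the proportion \<open>(2t + h) / (2\<pi> + h)\<close> of the mass.\<close>
lemma von_mises_prob_gain:
  assumes \<kappa>: "0 < \<kappa>0" "\<kappa>0 \<le> \<kappa>" and \<epsilon>: "0 < \<epsilon>" "\<epsilon> < 1 / 2" and \<tau>: "\<tau> \<in> {\<epsilon>..1 - \<epsilon>}"
  defines "h \<equiv> 2 * \<kappa>0 * (sin (pi * \<epsilon>) - pi * \<epsilon> * cos (pi * \<epsilon>))"
  shows "\<epsilon> * (h / (h + 2 * pi)) \<le> von_mises_prob \<kappa> \<tau> - \<tau>" and "0 < h"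
proof -
  define t where "t = pi * \<tau>"
  have t01: "0 < \<tau>" "\<tau> < 1"
    using \<epsilon> \<tau> by auto
  have t: "0 < t" "t < pi" "pi * \<epsilon> \<le> t"
    using t01 \<tau> by (auto simp: t_def)
  have e: "0 < pi * \<epsilon>" "pi * \<epsilon> < pi"
    using \<epsilon> by auto
  show h: "0 < h"
    using sin_minus_x_cos_pos[OF e] \<kappa> by (simp add: h_def)
  let ?A = "LINT u:{- t..t}|lborel. exp (\<kappa> * cos u)"
  let ?T = "exp_cos_total \<kappa>"
  define m where "m = exp (\<kappa> * cos t)"
  have m: "0 < m" by (simp add: m_def)
  have cos_ge: "cos t \<le> cos u" if "- t \<le> u" "u \<le> t" for u
    using cos_monotone_0_pi_le[of "\<bar>u\<bar>" t] that t by (simp add: abs_le_iff)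
  have cos_le: "cos u \<le> cos t" if "- pi \<le> u" "u \<le> pi" "\<not> (- t \<le> u \<and> u \<le> t)" for u
    using cos_monotone_0_pi_le[of t "\<bar>u\<bar>"] that t by (auto simp: abs_if split: if_splits)
  have A: "m * (2 * t + h) \<le> ?A"
  proof -
    let ?f = "\<lambda>u. 1 + \<kappa>0 * (cos u - cos t)"
    have "(LINT u|lborel. indicat_real {- t..t} u *\<^sub>R ?f u)
        = (t + \<kappa>0 * (sin t - t * cos t)) - (- t + \<kappa>0 * (sin (- t) - (- t) * cos t))"
      using t
      by (intro integral_FTC_atLeastAtMost[where F = "\<lambda>u. u + \<kappa>0 * (sin u - u * cos t)"])
        (auto intro!: derivative_eq_intros continuous_intros simp: has_real_derivative_iff_has_vector_derivative[symmetric])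
    also have "\<dots> = 2 * t + 2 * \<kappa>0 * (sin t - t * cos t)"
      by (simp add: algebra_simps)
    also have "\<dots> \<ge> 2 * t + h"
      using sin_minus_x_cos_mono[of "pi * \<epsilon>" t] e t \<kappa> by (simp add: h_def)
    finally have "m * (2 * t + h) \<le> m * (LINT u|lborel. indicat_real {- t..t} u *\<^sub>R ?f u)"
      using m by (intro mult_left_mono) auto
    also have "\<dots> = (LINT u|lborel. m * (indicat_real {- t..t} u *\<^sub>R ?f u))"
      by simp
    also have "\<dots> \<le> (LINT u|lborel. indicat_real {- t..t} u *\<^sub>R exp (\<kappa> * cos u))"
    proof (rule integral_mono)
      have "integrable lborel (\<lambda>u. indicat_real {- t..t} u *\<^sub>R ?f u)"
        using borel_integrable_compact[of "{- t..t}" ?f]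
        by (simp add: indicator_scaleR_eq_if continuous_intros)
      then show "integrable lborel (\<lambda>u. m * (indicat_real {- t..t} u *\<^sub>R ?f u))"
        by simp
      show "integrable lborel (\<lambda>u. indicat_real {- t..t} u *\<^sub>R exp (\<kappa> * cos u))"
        using integrable_exp_cos[of "- t" t \<kappa>] by (simp add: set_integrable_def)
      fix u
      show "m * (indicat_real {- t..t} u *\<^sub>R ?f u) \<le> indicat_real {- t..t} u *\<^sub>R exp (\<kappa> * cos u)"
      proof (cases "- t \<le> u \<and> u \<le> t")
        case True
        then have "?f u \<le> 1 + \<kappa> * (cos u - cos t)"
          using cos_ge[of u] \<kappa> by (intro add_left_mono mult_right_mono) auto
        also have "\<dots> \<le> exp (\<kappa> * (cos u - cos t))"
          by (rule exp_ge_add_one_self)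
        finally have "m * ?f u \<le> m * exp (\<kappa> * (cos u - cos t))"
          using m by (intro mult_left_mono) auto
        also have "\<dots> = exp (\<kappa> * cos u)"
          by (simp add: m_def exp_add[symmetric] algebra_simps)
        finally show ?thesis
          using True by simp
      qed (auto simp: indicator_def)
    qed
    finally show ?thesis
      by (simp add: set_lebesgue_integral_def)
  qed
  have T: "?T \<le> ?A + m * (2 * pi - 2 * t)"
  proof -
    have i: "integrable lborel (\<lambda>u. indicat_real {- t..t} u * exp (\<kappa> * cos u))"
        "integrable lborel (\<lambda>u. indicat_real {- pi..pi} u * exp (\<kappa> * cos u))"
      using integrable_exp_cos[of "- t" t \<kappa>] integrable_exp_cos[of "- pi" pi \<kappa>]
      by (auto simp: set_integrable_def)
    have "?T = (LINT u|lborel. indicat_real {- pi..pi} u * exp (\<kappa> * cos u))"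
      by (simp add: set_lebesgue_integral_def)
    also have "\<dots> \<le> (LINT u|lborel. indicat_real {- t..t} u * exp (\<kappa> * cos u)
        + m * (indicat_real {- pi..pi} u - indicat_real {- t..t} u))"
    proof (rule integral_mono)
      fix u
      show "indicat_real {- pi..pi} u * exp (\<kappa> * cos u) \<le> indicat_real {- t..t} u * exp (\<kappa> * cos u)
        + m * (indicat_real {- pi..pi} u - indicat_real {- t..t} u)"
        using cos_le[of u] \<kappa> t by (auto simp: indicator_def m_def)
    qed (intro i Bochner_Integration.integrable_add integrable_mult_right
        Bochner_Integration.integrable_diff integrable_real_indicator; simp add: emeasure_lborel_Icc_eq)+
    also have "\<dots> = ?A + m * (2 * pi - 2 * t)"
      using i t by (simp add: set_lebesgue_integral_def)
    finally show ?thesis .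
  qed
  \<comment> \<open>the excess of the rescaled mass of the window over its length\<close>
  define y where "y = ?A / m - 2 * t"
  have y: "h \<le> y" and Ay: "?A = m * (2 * t + y)"
    using A m by (auto simp: y_def field_simps)
  have "\<epsilon> * (h / (h + 2 * pi)) \<le> (1 - \<tau>) * (y / (y + 2 * pi))"
  proof (rule mult_mono)
    show "h / (h + 2 * pi) \<le> y / (y + 2 * pi)"
    proof -
      have "h * (y + 2 * pi) \<le> y * (h + 2 * pi)"
        using y by (simp add: algebra_simps)
      moreover have "0 < h + 2 * pi" "0 < y + 2 * pi"
        using h y pi_gt_zero by linarith+
      ultimately show ?thesis
        by (simp add: divide_le_eq le_divide_eq mult.commute)
    qed
  qed (use \<tau> h y \<epsilon> in auto)
  also have "\<dots> = (2 * t + y) / (y + 2 * pi) - \<tau>"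
  proof -
    have "y + pi * 2 \<noteq> 0"
      using h y pi_gt_zero by linarith
    then show ?thesis
      by (simp add: t_def field_simps)
  qed
  also have "(2 * t + y) / (y + 2 * pi) \<le> von_mises_prob \<kappa> \<tau>"
  proof -
    have "?T \<le> m * (y + 2 * pi)"
      using T unfolding Ay by (simp add: algebra_simps)
    moreover have "0 < ?T"
      by (rule exp_cos_total_pos)
    ultimately have "m * (2 * t + y) / (m * (y + 2 * pi)) \<le> m * (2 * t + y) / ?T"
      using m h y t by (intro divide_left_mono mult_pos_pos) auto
    then show ?thesis
      unfolding von_mises_prob_eq[OF t01] t_def[symmetric] Ay using m by simp
  qed
  finally show "\<epsilon> * (h / (h + 2 * pi)) \<le> von_mises_prob \<kappa> \<tau> - \<tau>"
    by simp
qed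

section \<open>A criterion for strong detection\<close>

text \<open>The coefficient of \<open>s\<^sup>2\<close> tends to \<open>1/2\<close> as \<open>s \<rightarrow> 0\<close>. This exact limit is what lets the false alarm
bound reach the critical constant.\<close>
lemma exp_minus_one_minus_le:
  fixes s :: real
  assumes "0 \<le> s"
  shows "exp s - 1 \<le> s + s\<^sup>2 / 2 * exp s"
proof -
  obtain t where t: "\<bar>t\<bar> \<le> \<bar>s\<bar>" "exp s = (\<Sum>m<2. s ^ m / fact m) + exp t / fact 2 * s ^ 2"
    using Maclaurin_exp_le[of s 2] by blast
  have "exp t \<le> exp s"
    using t(1) assms by simp
  then have "exp t * s\<^sup>2 / 2 \<le> s\<^sup>2 / 2 * exp s"
    using mult_right_mono[of "exp t" "exp s" "s\<^sup>2 / 2"] by (simp add: mult.commute)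
  moreover have "exp s = 1 + s + exp t * s\<^sup>2 / 2"
    using t(2) by (simp add: eval_nat_numeral)
  ultimately show ?thesis
    by linarith
qed

lemma exp_uminus_le_quadratic:
  fixes s :: real
  assumes "0 \<le> s"
  shows "exp (- s) - 1 \<le> - s + s\<^sup>2 / 2"
proof -
  obtain t where t: "exp (- s) = (\<Sum>m<3. (- s) ^ m / fact m) + exp t / fact 3 * (- s) ^ 3"
    using Maclaurin_exp_le[of "- s" 3] by blast
  have "0 \<le> exp t / fact 3 * s ^ 3"
    using assms by simp
  with t show ?thesis
    by (simp add: numeral_3_eq_3 numeral_2_eq_2)
qed

lemma von_mises_prob_bounds: "0 \<le> von_mises_prob \<kappa> \<tau>" "von_mises_prob \<kappa> \<tau> \<le> 1"
  using prob_space.prob_le_1[OF prob_space_von_mises] by (auto simp: von_mises_prob_def)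

text \<open>The Chernoff parameter for false alarms is \<open>s = t / \<lambda>\<close>, optimal to leading order, and \<open>s \<le> K / \<lambda> \<rightarrow> 0\<close>
makes the loss from \<open>e\<^sup>s - 1 - s \<le> (s\<^sup>2/2) e\<^sup>s\<close> negligible: the union bound is of order
\<open>N\<close> to the power \<open>1 - \<rho>\<^sup>2 (2 - e\<^sup>s)\<close>, and the exponent is eventually below \<open>1 - \<rho> < 0\<close>. For
misses the parameter is \<open>u = c / \<surd>\<mu>\<close>.\<close>
lemma interval_test_detects:
  fixes K :: "nat \<Rightarrow> nat" and \<kappa> \<tau> c :: "nat \<Rightarrow> real"
  assumes c: "filterlim c at_top sequentially"
    and K: "\<forall>\<^sub>F N in sequentially. K N \<le> N"
    and \<tau>: "\<forall>\<^sub>F N in sequentially. 0 < \<tau> N \<and> \<tau> N < 1"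
    and small: "(\<lambda>N. real (K N) / (real N * \<tau> N)) \<longlonglongrightarrow> 0"
    and \<rho>: "1 < \<rho>"
    and gain: "\<forall>\<^sub>F N in sequentially. \<rho> * sqrt (2 * (real N * \<tau> N) * ln (real N))
      \<le> window_gain (K N) (\<kappa> N) (\<tau> N)
        - c N * sqrt (real N * \<tau> N + window_gain (K N) (\<kappa> N) (\<tau> N))"
  shows "strong_detection_with K \<kappa>
    (\<lambda>N. interval_test N (\<tau> N) (interval_threshold N (K N) (\<kappa> N) (\<tau> N) (c N)))"
proof -
  define g where "g N = window_gain (K N) (\<kappa> N) (\<tau> N)" for N
  define lam where "lam N = real N * \<tau> N" for N
  define t where "t N = g N - c N * sqrt (lam N + g N)" for N
  define s where "s N = t N / lam N" for N
  define \<gamma> where "\<gamma> N = interval_threshold N (K N) (\<kappa> N) (\<tau> N) (c N)" for N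
  have \<gamma>: "\<gamma> N = lam N + t N" for N
    by (simp add: \<gamma>_def interval_threshold_def t_def lam_def g_def)
  have c0: "\<forall>\<^sub>F N in sequentially. 0 \<le> c N"
    using c by (simp add: filterlim_at_top)
  have basic: "\<forall>\<^sub>F N in sequentially. N \<ge> 1 \<and> K N \<le> N \<and> 0 < \<tau> N \<and> \<tau> N < 1 \<and> 0 < lam N \<and>
      0 \<le> t N \<and> 0 \<le> g N \<and> g N \<le> real (K N) \<and> t N \<le> real (K N) \<and> 0 \<le> c N \<and>
      2 * \<rho>\<^sup>2 * ln (real N) * lam N \<le> (t N)\<^sup>2"
    using K \<tau> gain c0 eventually_ge_at_top[of 1]
  proof eventually_elim
    case (elim N)
    have lam: "0 < lam N"
      using elim by (simp add: lam_def)
    have L: "0 \<le> ln (real N)"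
      using elim by simp
    have t_ge: "\<rho> * sqrt (2 * lam N * ln (real N)) \<le> t N"
      using elim by (simp add: t_def g_def lam_def)
    have r0: "0 \<le> \<rho> * sqrt (2 * lam N * ln (real N))"
      using \<rho> lam L by simp
    have "(\<rho> * sqrt (2 * lam N * ln (real N)))\<^sup>2 \<le> (t N)\<^sup>2"
      using t_ge r0 by (rule power_mono)
    then have sq: "2 * \<rho>\<^sup>2 * ln (real N) * lam N \<le> (t N)\<^sup>2"
      using lam L by (simp add: power_mult_distrib mult_ac)
    have "von_mises_prob (\<kappa> N) (\<tau> N) - \<tau> N \<le> 1"
      using von_mises_prob_bounds[of "\<kappa> N" "\<tau> N"] elim by linarith
    then have g: "g N \<le> real (K N)"
      unfolding g_def window_gain_def using mult_left_mono[of _ 1 "real (K N)"] by simp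
    have mu: "0 \<le> lam N + g N"
    proof -
      have "lam N + g N = (real N - real (K N)) * \<tau> N + real (K N) * von_mises_prob (\<kappa> N) (\<tau> N)"
        by (simp add: lam_def g_def window_gain_def algebra_simps)
      also have "\<dots> \<ge> 0"
        using elim von_mises_prob_bounds by simp
      finally show ?thesis .
    qed
    then have "0 \<le> c N * sqrt (lam N + g N)"
      using elim by simp
    then have "t N \<le> g N"
      by (simp add: t_def)
    with g r0 t_ge lam elim sq show ?case
      by linarith
  qed
  have s_le: "\<forall>\<^sub>F N in sequentially. s N \<le> real (K N) / lam N"
    using basic by eventually_elim (auto simp: s_def divide_right_mono)
  have s_ge: "\<forall>\<^sub>F N in sequentially. 0 \<le> s N"
    using basic by eventually_elim (auto simp: s_def)
  have s_lim: "s \<longlonglongrightarrow> 0"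
    using s_ge s_le tendsto_const small[folded lam_def] by (rule tendsto_sandwich)
  have "(\<lambda>N. \<rho>\<^sup>2 * (2 - exp (s N))) \<longlonglongrightarrow> \<rho>\<^sup>2 * (2 - exp 0)"
    by (intro tendsto_intros s_lim)
  moreover have "\<rho> < \<rho>\<^sup>2 * (2 - exp 0)"
    using \<rho> by (simp add: power2_eq_square)
  ultimately have rate: "\<forall>\<^sub>F N in sequentially. \<rho> < \<rho>\<^sup>2 * (2 - exp (s N))"
    by (rule order_tendstoD)
  have s_1: "\<forall>\<^sub>F N in sequentially. s N < 1"
    using s_lim by (rule order_tendstoD) simp
  have fa: "\<forall>\<^sub>F N in sequentially. p_fa N (interval_test N (\<tau> N) (\<gamma> N)) \<le> real N * exp (1 - \<rho> * ln (real N))"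
    using basic rate s_1 s_ge
  proof eventually_elim
    case (elim N)
    have lam: "0 < lam N" and L: "0 \<le> ln (real N)"
      using elim by auto
    have st: "s N * lam N = t N"
      using lam by (simp add: s_def)
    have "\<rho> / \<rho>\<^sup>2 < 2 - exp (s N)"
      using elim \<rho> by (simp add: field_simps)
    then have e2: "exp (s N) / 2 - 1 \<le> 0"
      using \<rho> by (smt (verit) divide_nonneg_nonneg zero_le_power2 field_sum_of_halves)
    have "(exp (s N) - 1) * lam N \<le> (s N + (s N)\<^sup>2 / 2 * exp (s N)) * lam N"
      using exp_minus_one_minus_le[of "s N"] elim lam by (intro mult_right_mono) auto
    also have "\<dots> = t N + s N * t N / 2 * exp (s N)"
      unfolding st[symmetric] by (simp add: algebra_simps power2_eq_square)
    finally have "s N + (exp (s N) - 1) * lam N - s N * \<gamma> N \<le> s N + t N + s N * t N / 2 * exp (s N) - s N * (lam N + t N)"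
      by (simp add: \<gamma>)
    also have "\<dots> = s N + (t N * s N) * (exp (s N) / 2 - 1)"
      using st by (simp add: algebra_simps)
    also have "(t N * s N) * (exp (s N) / 2 - 1) \<le> (2 * \<rho>\<^sup>2 * ln (real N)) * (exp (s N) / 2 - 1)"
    proof (rule mult_right_mono_neg[OF _ e2])
      show "2 * \<rho>\<^sup>2 * ln (real N) \<le> t N * s N"
        using elim lam by (simp add: s_def pos_le_divide_eq power2_eq_square)
    qed
    also have "s N + (2 * \<rho>\<^sup>2 * ln (real N)) * (exp (s N) / 2 - 1) = s N - (\<rho>\<^sup>2 * (2 - exp (s N))) * ln (real N)"
      by (simp add: algebra_simps)
    also have "\<dots> \<le> 1 - \<rho> * ln (real N)"
      using elim L by (intro diff_mono mult_right_mono) auto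
    finally have "real N * exp (s N + (exp (s N) - 1) * lam N - s N * \<gamma> N) \<le> real N * exp (1 - \<rho> * ln (real N))"
      by (intro mult_left_mono) auto
    moreover have "p_fa N (interval_test N (\<tau> N) (\<gamma> N)) \<le> real N * exp (s N + (exp (s N) - 1) * (real N * \<tau> N) - s N * \<gamma> N)"
      using elim by (intro false_alarm_bound) auto
    ultimately show ?case
      by (simp add: lam_def)
  qed
  have miss: "\<forall>\<^sub>F N in sequentially. p_miss N (K N) (\<kappa> N) (interval_test N (\<tau> N) (\<gamma> N)) \<le> exp (- (c N)\<^sup>2 / 2)"
    using basic
  proof eventually_elim
    case (elim N)
    define mu where "mu = lam N + g N"
    define u where "u = c N / sqrt mu"
    have mu: "0 < mu"
      using elim by (simp add: mu_def)
    then have u: "0 \<le> u" "u * sqrt mu = c N"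
      using elim by (auto simp: u_def)
    then have umu: "u * mu = c N * sqrt mu" "u\<^sup>2 * mu = (c N)\<^sup>2"
      using mu by (metis mult.assoc real_sqrt_mult_self abs_of_pos)
        (metis u(2) mu power_mult_distrib real_sqrt_pow2 less_imp_le)
    have g': "\<gamma> N = mu - c N * sqrt mu"
      by (simp add: \<gamma> t_def mu_def)
    have "p_miss N (K N) (\<kappa> N) (interval_test N (\<tau> N) (\<gamma> N)) \<le> exp ((exp (- u) - 1) * mu + u * \<gamma> N)"
      using elim u miss_bound[of "K N" N u "\<tau> N" "\<kappa> N" "\<gamma> N"] by (simp add: mu_def lam_def g_def)
    also have "\<dots> \<le> exp ((- u + u\<^sup>2 / 2) * mu + u * \<gamma> N)"
      using exp_uminus_le_quadratic[OF u(1)] mu by (simp add: mult_right_mono)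
    also have "(- u + u\<^sup>2 / 2) * mu + u * \<gamma> N = (u\<^sup>2 * mu) / 2 - c N * (u * sqrt mu)"
      unfolding g' by (simp add: algebra_simps)
    also have "\<dots> = - (c N)\<^sup>2 / 2"
      unfolding umu u(2) by (simp add: power2_eq_square)
    finally show ?case by simp
  qed
  have "(\<lambda>N. p_fa N (interval_test N (\<tau> N) (\<gamma> N))) \<longlonglongrightarrow> 0"
  proof (rule tendsto_sandwich[OF _ fa tendsto_const])
    show "\<forall>\<^sub>F N in sequentially. 0 \<le> p_fa N (interval_test N (\<tau> N) (\<gamma> N))"
      by (simp add: p_fa_def)
    show "(\<lambda>N. real N * exp (1 - \<rho> * ln (real N))) \<longlonglongrightarrow> 0"
      using \<rho> by real_asymp
  qed
  moreover have "(\<lambda>N. p_miss N (K N) (\<kappa> N) (interval_test N (\<tau> N) (\<gamma> N))) \<longlonglongrightarrow> 0"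
  proof (rule tendsto_sandwich[OF _ miss tendsto_const])
    show "\<forall>\<^sub>F N in sequentially. 0 \<le> p_miss N (K N) (\<kappa> N) (interval_test N (\<tau> N) (\<gamma> N))"
      by (simp add: p_miss_def)
    have "((\<lambda>x::real. exp (- x\<^sup>2 / 2)) \<longlongrightarrow> 0) at_top"
      by real_asymp
    then show "(\<lambda>N. exp (- (c N)\<^sup>2 / 2)) \<longlonglongrightarrow> 0"
      using c by (rule filterlim_compose)
  qed
  ultimately show ?thesis
    unfolding strong_detection_with_def \<gamma>_def by (simp add: is_test_interval_test)
qed

section \<open>The two regimes\<close>
lemma power_size_bounds:
  assumes "power_size K \<alpha>"
  shows "real N powr \<alpha> - 1 \<le> real (K N)" "real (K N) \<le> real N powr \<alpha> + 1"
proof -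
  have "int (K N) = \<lfloor>real N powr \<alpha>\<rfloor> \<or> int (K N) = \<lceil>real N powr \<alpha>\<rceil>"
    using assms by (simp add: power_size_def)
  then have "real_of_int (int (K N)) \<ge> real N powr \<alpha> - 1 \<and> real_of_int (int (K N)) \<le> real N powr \<alpha> + 1"
    by (elim disjE; simp only:) linarith+
  then show "real N powr \<alpha> - 1 \<le> real (K N)" "real (K N) \<le> real N powr \<alpha> + 1"
    by auto
qed

lemma power_size_le:
  assumes "power_size K \<alpha>" "\<alpha> \<le> 1" "N \<ge> 1"
  shows "K N \<le> N"
proof -
  have "real N powr \<alpha> \<le> real N powr 1"
    using assms by (intro powr_mono) auto
  then have "real N powr \<alpha> \<le> real_of_int (int N)"
    using assms(3) by simp
  then have "\<lfloor>real N powr \<alpha>\<rfloor> \<le> int N" "\<lceil>real N powr \<alpha>\<rceil> \<le> int N"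
    by linarith+
  then show ?thesis
    using assms(1) by (metis power_size_def of_nat_le_iff)
qed

text \<open>With \<open>L = log N\<close> and \<open>k = K\<close>, the scaling of \<open>\<kappa>\<close> makes \<open>N \<tau> = a k\<^sup>2 / L\<close> an identity, so the
criterion, divided by \<open>k\<close>, compares \<open>\<rho> sqrt (2 a)\<close> with
\<open>p\<^sub>\<kappa>(\<tau>) - \<tau> - (c / \<surd>L) sqrt (a + L / k)\<close>, which tends to \<open>q\<close>.\<close>
lemma detection_concentrated:
  fixes K :: "nat \<Rightarrow> nat" and \<kappa> \<tau> c :: "nat \<Rightarrow> real"
  assumes K: "power_size K \<alpha>" and \<kappa>: "\<forall>N. \<kappa> N > 0" and c: "filterlim c at_top sequentially"
    and \<alpha>: "0 < \<alpha>" "\<alpha> \<le> 1 / 2" and c1: "c1 > critical_const"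
    and c2: "is_arg_min window_cost (\<lambda>c. c > 0) c2"
    and eq: "\<forall>\<^sub>F N in sequentially. 1 / sqrt (\<kappa> N) = (real (K N))\<^sup>2 / (c1 * real N * ln (real N))"
    and \<tau>: "\<forall>N. \<tau> N = c2 / (pi * sqrt (\<kappa> N))"
    and co: "c \<in> o(\<lambda>N. sqrt (ln (real N)))"
  shows "strong_detection_with K \<kappa>
    (\<lambda>N. interval_test N (\<tau> N) (interval_threshold N (K N) (\<kappa> N) (\<tau> N) (c N)))"
proof -
  define q where "q = gaussian_window c2"
  have c2pos: "0 < c2"
    using c2 by (simp add: is_arg_min_def)
  have q: "0 < q"
    unfolding q_def by (rule gaussian_window_pos[OF c2pos])
  have cc: "critical_const = 2 / pi * (c2 / q\<^sup>2)"
    unfolding q_def by (rule critical_const_eq[OF c2])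
  have "0 < critical_const"
    unfolding cc using c2pos q by simp
  with c1 have c1pos: "0 < c1" by simp
  define a where "a = c2 / (pi * c1)"
  have a: "0 < a"
    using c2pos c1pos by (simp add: a_def)
  have "2 * a < q\<^sup>2"
    using c1 c1pos q unfolding cc a_def by (simp add: field_simps)
  then have aq: "sqrt (2 * a) < q"
    using q by (metis real_sqrt_less_iff real_sqrt_unique less_imp_le)
  \<comment> \<open>the midpoint between \<open>1\<close> and the ratio \<open>q / sqrt (2 a)\<close>, which exceeds \<open>1\<close> as \<open>c1\<close> is supercritical\<close>
  define \<rho> where "\<rho> = (1 + q / sqrt (2 * a)) / 2"
  have ratio: "1 < q / sqrt (2 * a)"
    using aq a by (simp add: field_simps)
  then have \<rho>: "1 < \<rho>"
    by (simp add: \<rho>_def)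
  have "\<rho> < q / sqrt (2 * a)"
  proof -
    have "(1 + r) / 2 < r" if "1 < r" for r :: real
      using that by simp
    then show ?thesis
      unfolding \<rho>_def using ratio by blast
  qed
  then have \<rho>q: "\<rho> * sqrt (2 * a) < q"
    using a by (simp add: field_simps)
  have Kbig: "\<forall>\<^sub>F N in sequentially. 1 < real N powr \<alpha>"
    using \<alpha>(1) by real_asymp
  have Kpos: "\<forall>\<^sub>F N in sequentially. 0 < real (K N)"
    using Kbig by eventually_elim (use power_size_bounds(1)[OF K] in \<open>smt (verit)\<close>)
  have LK: "(\<lambda>N. ln (real N) / real (K N)) \<longlonglongrightarrow> 0"
  proof (rule tendsto_sandwich)
    show "\<forall>\<^sub>F N in sequentially. 0 \<le> ln (real N) / real (K N)"
      using eventually_ge_at_top[of 1] by eventually_elim auto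
    show "\<forall>\<^sub>F N in sequentially. ln (real N) / real (K N) \<le> ln (real N) / (real N powr \<alpha> - 1)"
      using eventually_ge_at_top[of 1] Kbig
    proof eventually_elim
      case (elim N)
      then show ?case
        using power_size_bounds(1)[OF K, of N] by (intro divide_left_mono mult_pos_pos) auto
    qed
    show "(\<lambda>N. ln (real N) / (real N powr \<alpha> - 1)) \<longlonglongrightarrow> 0"
      using \<alpha>(1) by real_asymp
  qed auto
  have inv: "(\<lambda>N. 1 / sqrt (\<kappa> N)) \<longlonglongrightarrow> 0"
  proof (rule tendsto_sandwich)
    show "\<forall>\<^sub>F N in sequentially. 0 \<le> 1 / sqrt (\<kappa> N)"
      using \<kappa> by (simp add: less_imp_le)
    show "\<forall>\<^sub>F N in sequentially. 1 / sqrt (\<kappa> N) \<le> (sqrt (real N) + 1)\<^sup>2 / (c1 * real N * ln (real N))"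
      using eq eventually_ge_at_top[of 1]
    proof eventually_elim
      case (elim N)
      have "real N powr \<alpha> \<le> real N powr (1 / 2)"
        using \<alpha> elim by (intro powr_mono) auto
      then have "real (K N) \<le> sqrt (real N) + 1"
        using power_size_bounds(2)[OF K, of N] by (simp add: powr_half_sqrt)
      then have "(real (K N))\<^sup>2 \<le> (sqrt (real N) + 1)\<^sup>2"
        by (intro power_mono) auto
      then show ?case
        using elim c1pos by (auto intro!: divide_right_mono)
    qed
    show "(\<lambda>N. (sqrt (real N) + 1)\<^sup>2 / (c1 * real N * ln (real N))) \<longlonglongrightarrow> 0"
      using c1pos by real_asymp
  qed auto
  have "filterlim (\<lambda>N. sqrt (\<kappa> N)) at_top sequentially"
  proof -
    have "filterlim (\<lambda>N. inverse (1 / sqrt (\<kappa> N))) at_top sequentially"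
      using \<kappa> by (intro filterlim_inverse_at_top inv) auto
    then show ?thesis by simp
  qed
  then have "filterlim (\<lambda>N. sqrt (\<kappa> N) * sqrt (\<kappa> N)) at_top sequentially"
    using filterlim_at_top_mult_at_top by blast
  then have \<kappa>_top: "filterlim \<kappa> at_top sequentially"
    using \<kappa> by (simp add: less_imp_le)
  have p_lim: "(\<lambda>N. von_mises_prob (\<kappa> N) (\<tau> N)) \<longlonglongrightarrow> q"
    using filterlim_compose[OF von_mises_prob_limit[OF c2pos] \<kappa>_top] \<tau> by (simp add: q_def)
  have \<tau>_lim: "\<tau> \<longlonglongrightarrow> 0"
  proof -
    have "(\<lambda>N. c2 / pi * (1 / sqrt (\<kappa> N))) \<longlonglongrightarrow> c2 / pi * 0"
      by (intro tendsto_intros inv)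
    moreover have "(\<lambda>N. c2 / pi * (1 / sqrt (\<kappa> N))) = \<tau>"
      using \<tau> by auto
    ultimately show ?thesis
      by simp
  qed
  have \<tau>_pos: "0 < \<tau> N" for N
    using \<tau> c2pos \<kappa> by simp
  have mean: "\<forall>\<^sub>F N in sequentially. real N * \<tau> N = a * (real (K N))\<^sup>2 / ln (real N)"
    using eq eventually_gt_at_top[of 1]
  proof eventually_elim
    case (elim N)
    have "real N * \<tau> N = real N * (c2 / pi * (1 / sqrt (\<kappa> N)))"
      using \<tau> by simp
    also have "\<dots> = a * (real (K N))\<^sup>2 / ln (real N)"
      unfolding elim(1) using elim(2) c1pos by (simp add: a_def field_simps)
    finally show ?case .
  qed
  show ?thesis
  proof (rule interval_test_detects[OF c _ _ _ \<rho>])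
    show "\<forall>\<^sub>F N in sequentially. K N \<le> N"
      using eventually_ge_at_top[of 1] by eventually_elim (use power_size_le[OF K] \<alpha> in auto)
    show "\<forall>\<^sub>F N in sequentially. 0 < \<tau> N \<and> \<tau> N < 1"
      using order_tendstoD(2)[OF \<tau>_lim zero_less_one] by eventually_elim (use \<tau>_pos in auto)
    have "(\<lambda>N. ln (real N) / real (K N) / a) \<longlonglongrightarrow> 0 / a"
      by (intro tendsto_divide LK tendsto_const) (use a in auto)
    moreover have "\<forall>\<^sub>F N in sequentially. ln (real N) / real (K N) / a = real (K N) / (real N * \<tau> N)"
      using mean Kpos eventually_gt_at_top[of 1]
    proof eventually_elim
      case (elim N)
      show ?case
        unfolding elim(1) using elim(2,3) a by (simp add: power2_eq_square)
    qed
    ultimately show "(\<lambda>N. real (K N) / (real N * \<tau> N)) \<longlonglongrightarrow> 0"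
      by (auto intro: Lim_transform_eventually)
    have "(\<lambda>N. c N / sqrt (ln (real N))) \<longlonglongrightarrow> 0"
      using co by (rule smalloD_tendsto)
    then have "(\<lambda>N. (von_mises_prob (\<kappa> N) (\<tau> N) - \<tau> N)
        - c N / sqrt (ln (real N)) * sqrt (a + ln (real N) / real (K N))) \<longlonglongrightarrow> (q - 0) - 0 * sqrt (a + 0)"
      by (intro tendsto_intros p_lim \<tau>_lim LK)
    then have "\<forall>\<^sub>F N in sequentially. \<rho> * sqrt (2 * a) < (von_mises_prob (\<kappa> N) (\<tau> N) - \<tau> N)
        - c N / sqrt (ln (real N)) * sqrt (a + ln (real N) / real (K N))"
      using \<rho>q by (intro order_tendstoD(1)) auto
    moreover have "\<forall>\<^sub>F N in sequentially. 0 \<le> c N"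
      using c by (simp add: filterlim_at_top)
    ultimately show "\<forall>\<^sub>F N in sequentially. \<rho> * sqrt (2 * (real N * \<tau> N) * ln (real N))
      \<le> window_gain (K N) (\<kappa> N) (\<tau> N)
        - c N * sqrt (real N * \<tau> N + window_gain (K N) (\<kappa> N) (\<tau> N))"
      using mean Kpos eventually_gt_at_top[of 1]
    proof eventually_elim
      case (elim N)
      define L where "L = ln (real N)"
      define k where "k = real (K N)"
      have L: "0 < L" and k: "0 < k"
        using elim by (auto simp: L_def k_def)
      have m: "real N * \<tau> N = a * k\<^sup>2 / L"
        using elim by (simp add: L_def k_def)
      have "von_mises_prob (\<kappa> N) (\<tau> N) - \<tau> N \<le> 1"
        using von_mises_prob_bounds[of "\<kappa> N" "\<tau> N"] \<tau>_pos[of N] by linarith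
      then have "window_gain (K N) (\<kappa> N) (\<tau> N) \<le> k"
        using k by (simp add: window_gain_def k_def mult_left_le)
      then have "sqrt (real N * \<tau> N + window_gain (K N) (\<kappa> N) (\<tau> N)) \<le> sqrt (a * k\<^sup>2 / L + k)"
        using m by simp
      also have "a * k\<^sup>2 / L + k = (k / sqrt L)\<^sup>2 * (a + L / k)"
        using L k by (simp add: field_simps power2_eq_square)
      also have "sqrt \<dots> = k / sqrt L * sqrt (a + L / k)"
        using L k by (simp add: real_sqrt_mult)
      finally have "c N * sqrt (real N * \<tau> N + window_gain (K N) (\<kappa> N) (\<tau> N)) \<le> c N * (k / sqrt L * sqrt (a + L / k))"
        using elim by (intro mult_left_mono) auto
      also have "\<dots> = k * (c N / sqrt L * sqrt (a + L / k))"
        by simp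
      finally have "k * ((von_mises_prob (\<kappa> N) (\<tau> N) - \<tau> N) - c N / sqrt L * sqrt (a + L / k))
          \<le> window_gain (K N) (\<kappa> N) (\<tau> N) - c N * sqrt (real N * \<tau> N + window_gain (K N) (\<kappa> N) (\<tau> N))"
        by (simp add: window_gain_def k_def right_diff_distrib)
      moreover have "k * (\<rho> * sqrt (2 * a)) \<le> k * ((von_mises_prob (\<kappa> N) (\<tau> N) - \<tau> N) - c N / sqrt L * sqrt (a + L / k))"
        using elim k by (intro mult_left_mono) (auto simp: L_def k_def)
      moreover have "sqrt (2 * (real N * \<tau> N) * ln (real N)) = k * sqrt (2 * a)"
      proof -
        have "2 * (real N * \<tau> N) * ln (real N) = k\<^sup>2 * (2 * a)"
          unfolding m L_def[symmetric] using L by simp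
        moreover have "sqrt (k\<^sup>2 * (2 * a)) = k * sqrt (2 * a)"
          using k by (simp only: real_sqrt_mult real_sqrt_abs abs_of_pos)
        ultimately show ?thesis
          by (simp only:)
      qed
      ultimately show ?case
        by (simp add: mult_ac)
    qed
  qed
qed

text \<open>The mean \<open>\<mu>\<close> is at most \<open>N\<close>, so \<open>c \<surd>\<mu> = o(K)\<close>, and \<open>sqrt (N log N) = o(K)\<close> because \<open>\<alpha> > 1/2\<close>. Each of
these two terms takes up at most half of the gain \<open>\<delta> K\<close>.\<close>
lemma detection_large_subset:
  fixes K :: "nat \<Rightarrow> nat" and \<kappa> \<tau> c :: "nat \<Rightarrow> real"
  assumes K: "power_size K \<alpha>" and \<kappa>: "\<forall>N. \<kappa> N > 0" and c: "filterlim c at_top sequentially"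
    and \<alpha>: "1 / 2 < \<alpha>" "\<alpha> < 1" and \<kappa>1: "\<kappa> \<in> \<Omega>(\<lambda>_. 1)"
    and \<epsilon>: "0 < \<epsilon>" "\<epsilon> < 1 / 2" and \<tau>: "\<forall>N. \<tau> N \<in> {\<epsilon>..1 - \<epsilon>}"
    and co: "c \<in> o(\<lambda>N. real (K N) / sqrt (real N))"
  shows "strong_detection_with K \<kappa>
    (\<lambda>N. interval_test N (\<tau> N) (interval_threshold N (K N) (\<kappa> N) (\<tau> N) (c N)))"
proof -
  obtain \<kappa>0 where \<kappa>0: "0 < \<kappa>0" "\<forall>\<^sub>F N in sequentially. \<kappa>0 \<le> \<kappa> N"
    using \<kappa>1 \<kappa> by (elim landau_omega.bigE) (auto simp: abs_of_pos)
  define h where "h = 2 * \<kappa>0 * (sin (pi * \<epsilon>) - pi * \<epsilon> * cos (pi * \<epsilon>))"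
  define \<delta> where "\<delta> = \<epsilon> * (h / (h + 2 * pi))"
  have "0 < h"
    unfolding h_def using von_mises_prob_gain(2)[OF \<kappa>0(1) order_refl \<epsilon>, of \<epsilon>] \<epsilon> by auto
  then have \<delta>: "0 < \<delta>"
    using \<epsilon> by (simp add: \<delta>_def add_pos_pos)
  have gain: "\<forall>\<^sub>F N in sequentially. \<delta> \<le> von_mises_prob (\<kappa> N) (\<tau> N) - \<tau> N"
    using \<kappa>0(2) by eventually_elim (use von_mises_prob_gain(1)[OF \<kappa>0(1) _ \<epsilon>] \<tau> in \<open>auto simp: \<delta>_def h_def\<close>)
  have \<tau>01: "0 < \<tau> N" "\<tau> N < 1" "\<epsilon> \<le> \<tau> N" for N
    using \<tau>[rule_format, of N] \<epsilon> by auto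
  have K_le: "\<forall>\<^sub>F N in sequentially. K N \<le> N"
    using eventually_ge_at_top[of 1] by eventually_elim (use power_size_le[OF K] \<alpha> in auto)
  show ?thesis
  proof (rule interval_test_detects[where \<rho> = 2, OF c K_le])
    show "\<forall>\<^sub>F N in sequentially. 0 < \<tau> N \<and> \<tau> N < 1"
      using \<tau>01 by simp
    show "(\<lambda>N. real (K N) / (real N * \<tau> N)) \<longlonglongrightarrow> 0"
    proof (rule tendsto_sandwich)
      show "\<forall>\<^sub>F N in sequentially. 0 \<le> real (K N) / (real N * \<tau> N)"
        using \<tau>01 by (simp add: less_imp_le)
      show "\<forall>\<^sub>F N in sequentially. real (K N) / (real N * \<tau> N) \<le> (real N powr \<alpha> + 1) / (real N * \<epsilon>)"
        using eventually_ge_at_top[of 1]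
      proof eventually_elim
        case (elim N)
        then show ?case
          using power_size_bounds(2)[OF K, of N] \<tau>01[of N] \<epsilon> by (intro frac_le mult_left_mono) auto
      qed
      show "(\<lambda>N. (real N powr \<alpha> + 1) / (real N * \<epsilon>)) \<longlonglongrightarrow> 0"
        using \<alpha> \<epsilon> by real_asymp
    qed auto
    have big: "\<forall>\<^sub>F N in sequentially. 2 * sqrt (2 * real N * ln (real N)) \<le> \<delta> / 2 * (real N powr \<alpha> - 1)"
      using \<alpha> \<delta> by real_asymp
    have small: "\<forall>\<^sub>F N in sequentially. norm (c N) \<le> \<delta> / 2 * norm (real (K N) / sqrt (real N))"
      using co \<delta> by (intro landau_o.smallD) auto
    show "\<forall>\<^sub>F N in sequentially. 2 * sqrt (2 * (real N * \<tau> N) * ln (real N))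
      \<le> window_gain (K N) (\<kappa> N) (\<tau> N)
        - c N * sqrt (real N * \<tau> N + window_gain (K N) (\<kappa> N) (\<tau> N))"
      using big small gain K_le eventually_ge_at_top[of 1]
    proof eventually_elim
      case (elim N)
      have g: "\<delta> * real (K N) \<le> window_gain (K N) (\<kappa> N) (\<tau> N)"
        using mult_left_mono[OF elim(3), of "real (K N)"] by (simp add: window_gain_def mult.commute)
      have "window_gain (K N) (\<kappa> N) (\<tau> N) \<le> real N * (1 - \<tau> N)"
        unfolding window_gain_def using elim von_mises_prob_bounds[of "\<kappa> N" "\<tau> N"] \<tau>01[of N]
        by (intro mult_mono) (use \<delta> in linarith)+
      then have "real N * \<tau> N + window_gain (K N) (\<kappa> N) (\<tau> N) \<le> real N"
        by (simp add: algebra_simps)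
      moreover have "0 \<le> real N * \<tau> N + window_gain (K N) (\<kappa> N) (\<tau> N)"
        using g \<delta> \<tau>01[of N] by (smt (verit) mult_nonneg_nonneg of_nat_0_le_iff)
      ultimately have "\<bar>c N\<bar> * sqrt (real N * \<tau> N + window_gain (K N) (\<kappa> N) (\<tau> N)) \<le> \<bar>c N\<bar> * sqrt (real N)"
        by (intro mult_left_mono) auto
      also have "\<dots> \<le> \<delta> / 2 * (real (K N) / sqrt (real N)) * sqrt (real N)"
        using elim by (intro mult_right_mono) auto
      also have "\<dots> = \<delta> / 2 * real (K N)"
        using elim by simp
      finally have "c N * sqrt (real N * \<tau> N + window_gain (K N) (\<kappa> N) (\<tau> N)) \<le> \<delta> / 2 * real (K N)"
        using \<open>0 \<le> real N * \<tau> N + window_gain (K N) (\<kappa> N) (\<tau> N)\<close>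
        by (smt (verit) mult_right_mono real_sqrt_ge_zero)
      moreover have "2 * sqrt (2 * (real N * \<tau> N) * ln (real N)) \<le> \<delta> / 2 * real (K N)"
      proof -
        have "2 * sqrt (2 * (real N * \<tau> N) * ln (real N)) \<le> 2 * sqrt (2 * real N * ln (real N))"
          using elim \<tau>01[of N] by (simp add: mult_left_le mult_right_mono)
        also have "\<dots> \<le> \<delta> / 2 * (real N powr \<alpha> - 1)"
          by (rule elim(1))
        also have "\<dots> \<le> \<delta> / 2 * real (K N)"
          using power_size_bounds(1)[OF K, of N] \<delta> by (intro mult_left_mono) auto
        finally show ?thesis .
      qed
      ultimately show ?case
        using g by (simp add: field_simps)
    qed
  qed simp
qed

theorem corollary3:
  fixes K :: "nat \<Rightarrow> nat" and \<kappa> \<tau> c :: "nat \<Rightarrow> real" and \<alpha> :: real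
  assumes K: "power_size K \<alpha>"
    and \<kappa>: "\<forall>N. \<kappa> N > 0"
    and c: "filterlim c at_top sequentially"
  shows
    "(\<exists>c2. is_arg_min window_cost (\<lambda>c. c > 0) c2) \<and>
     (\<forall>c1 c2.
        0 < \<alpha> \<longrightarrow> \<alpha> \<le> 1 / 2 \<longrightarrow>
        c1 > critical_const \<longrightarrow>
        is_arg_min window_cost (\<lambda>c. c > 0) c2 \<longrightarrow>
        (\<forall>\<^sub>F N in sequentially.
           1 / sqrt (\<kappa> N) = (real (K N))\<^sup>2 / (c1 * real N * ln (real N))) \<longrightarrow>
        (\<forall>N. \<tau> N = c2 / (pi * sqrt (\<kappa> N))) \<longrightarrow>
        c \<in> o(\<lambda>N. sqrt (ln (real N))) \<longrightarrow>
        strong_detection_with K \<kappa>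
          (\<lambda>N. interval_test N (\<tau> N) (interval_threshold N (K N) (\<kappa> N) (\<tau> N) (c N)))) \<and>
     (\<forall>\<epsilon>.
        1 / 2 < \<alpha> \<longrightarrow> \<alpha> < 1 \<longrightarrow>
        \<kappa> \<in> \<Omega>(\<lambda>_. 1) \<longrightarrow>
        0 < \<epsilon> \<longrightarrow> \<epsilon> < 1 / 2 \<longrightarrow>
        (\<forall>N. \<tau> N \<in> {\<epsilon>..1 - \<epsilon>}) \<longrightarrow>
        c \<in> o(\<lambda>N. real (K N) / sqrt (real N)) \<longrightarrow>
        strong_detection_with K \<kappa>
          (\<lambda>N. interval_test N (\<tau> N) (interval_threshold N (K N) (\<kappa> N) (\<tau> N) (c N))))"
proof (intro conjI allI impI)
  show "\<exists>c2. is_arg_min window_cost (\<lambda>c. c > 0) c2"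
    by (rule window_cost_minimizer)
qed (intro detection_concentrated[OF K \<kappa> c] detection_large_subset[OF K \<kappa> c]; assumption)+

end
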